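(* Let $X=V(f)\subseteq \mathbb{P}_k^{n-1}$ be a Veronese-Avoiding hypersurface of degree $d\ge 3$. Set $T=n(d-2)$. Then, for a general linear form $\ell\in R_1$, the multiplication map \[ \ell^{\,T-2}:(M_f)_1\longrightarrow (M_f)_{T-1} \] is an isomorphism.
   Context: $k$ is an algebraically closed field of characteristic zero, $R=k[x_1,\ldots,x_n]$ is the standard graded polynomial ring with graded pieces $R_m$, and $f\in R_d$ is a reduced (squarefree) homogeneous polynomial. The gradient ideal is $J_f=(\partial f/\partial x_1,\ldots,\partial f/\partial x_n)$, with degree-$m$ piece $(J_f)_m$, and the Milnor algebra is $M_f=R/J_f$, graded with pieces $(M_f)_m=R_m/(J_f)_m$. $\mathbb{P}((J_f)_m)\subseteq\mathbb{P}(R_m)$ is the projective linear subspace attached to $(J_f)_m$, of codimension $\dim_k R_m-\dim_k (J_f)_m$. The Veronese variety $V_n^m\subseteq \mathbb{P}(R_m)$ is the image of $\mathbb{P}(R_1)\to\mathbb{P}(R_m)$, $[\ell]\mapsto[\ell^m]$. A reduced hypersurface $X=V(f)$ of degree $d\ge3$ is called Veronese-Avoiding if (I) $\mathrm{codim}_{\mathbb{P}(R_{T-1})}\mathbb{P}((J_f)_{T-1})=n$ and (II) $\mathbb{P}((J_f)_{T-1})\cap V_n^{T-1}=\emptyset$, where $T=n(d-2)$. "For a general linear form" means for all $\ell$ in some nonempty Zariski-open subset of $R_1$. *)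

theory Defs
  imports
    "HOL-Library.Poly_Mapping"
    "HOL-Library.Set_Algebras"
    "HOL-Library.Cardinality"
    "HOL-Computational_Algebra.Polynomial"
    "HOL-Computational_Algebra.Squarefree"
begin

text \<open>
  The polynomial ring over \<open>'k\<close> in the variables \<open>x\<^sub>i\<close>, \<open>i :: 'n\<close>. For finite \<open>'n\<close> this is
  \<open>k[x\<^sub>1, \<dots>, x\<^sub>n]\<close> with \<open>n = CARD('n)\<close>. The product is the convolution product of
  the library, and exponent vectors are added pointwise.
\<close>
type_synonym ('n, 'k) mpoly = "('n \<Rightarrow>\<^sub>0 nat) \<Rightarrow>\<^sub>0 'k"

definition scale :: "'k::field \<Rightarrow> ('n, 'k) mpoly \<Rightarrow> ('n, 'k) mpoly" where
  "scale c p = Poly_Mapping.single 0 c * p"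

global_interpretation mpoly_vs: vector_space "scale :: 'k::field \<Rightarrow> ('n, 'k) mpoly \<Rightarrow> _"
  by unfold_locales
    (simp_all add: scale_def algebra_simps single_add mult_single flip: mult.assoc)

definition mdeg :: "('n::finite \<Rightarrow>\<^sub>0 nat) \<Rightarrow> nat" where
  "mdeg m = (\<Sum>i\<in>UNIV. Poly_Mapping.lookup m i)"

definition homog :: "nat \<Rightarrow> ('n::finite, 'k::field) mpoly set" where
  "homog e = {p. \<forall>m\<in>Poly_Mapping.keys p. mdeg m = e}"

text \<open>For exponents \<open>m\<close> not involving \<open>i\<close> the truncated subtraction below is harmless,
  since the coefficient vanishes.\<close>
definition partial :: "'n \<Rightarrow> ('n, 'k::field) mpoly \<Rightarrow> ('n, 'k) mpoly" where
  "partial i p = (\<Sum>m\<in>Poly_Mapping.keys p.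
     Poly_Mapping.single (m - Poly_Mapping.single i 1)
       (of_nat (Poly_Mapping.lookup m i) * Poly_Mapping.lookup p m))"

definition meval :: "('n::finite \<Rightarrow> 'k::field) \<Rightarrow> ('n, 'k) mpoly \<Rightarrow> 'k" where
  "meval a p = (\<Sum>m\<in>Poly_Mapping.keys p.
     Poly_Mapping.lookup p m * (\<Prod>i\<in>UNIV. a i ^ Poly_Mapping.lookup m i))"

text \<open>The ideal generated by the partials: the span in the ring as a module over itself.\<close>
definition gradient_ideal :: "('n::finite, 'k::field) mpoly \<Rightarrow> ('n, 'k) mpoly set" where
  "gradient_ideal f = module.span (*) (range (\<lambda>i. partial i f))"

definition gradient_piece :: "('n::finite, 'k::field) mpoly \<Rightarrow> nat \<Rightarrow> ('n, 'k) mpoly set" where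
  "gradient_piece f m = gradient_ideal f \<inter> homog m"

text \<open>
  The graded piece \<open>(M\<^sub>f)\<^sub>m = R\<^sub>m / (J\<^sub>f)\<^sub>m\<close> as a set of cosets. Cosets are added by the
  elementwise sum \<open>X + Y\<close> of sets; the scalar multiple is saturated again so that
  it is the correct coset also for \<open>c = 0\<close>.
\<close>
definition milnor_piece :: "('n::finite, 'k::field) mpoly \<Rightarrow> nat \<Rightarrow> ('n, 'k) mpoly set set" where
  "milnor_piece f m = (\<lambda>p. p +o gradient_piece f m) ` homog m"

definition milnor_scale ::
    "('n::finite, 'k::field) mpoly \<Rightarrow> nat \<Rightarrow> 'k \<Rightarrow> ('n, 'k) mpoly set \<Rightarrow> ('n, 'k) mpoly set" where
  "milnor_scale f m c X = scale c ` X + gradient_piece f m"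

text \<open>Multiplication by \<open>g\<close> into the piece of degree \<open>e\<close>: the coset of \<open>p\<close> goes to the
  coset of \<open>g * p\<close>. Meaningful when \<open>g\<close> is homogeneous of the complementary degree.\<close>
definition milnor_mult ::
    "('n::finite, 'k::field) mpoly \<Rightarrow> ('n, 'k) mpoly \<Rightarrow> nat \<Rightarrow>
     ('n, 'k) mpoly set \<Rightarrow> ('n, 'k) mpoly set" where
  "milnor_mult f g e X = (\<lambda>p. g * p) ` X + gradient_piece f e"

definition milnor_iso ::
    "('n::finite, 'k::field) mpoly \<Rightarrow> nat \<Rightarrow> nat \<Rightarrow>
     (('n, 'k) mpoly set \<Rightarrow> ('n, 'k) mpoly set) \<Rightarrow> bool" where
  "milnor_iso f a b \<phi> \<longleftrightarrow>
     bij_betw \<phi> (milnor_piece f a) (milnor_piece f b) \<and>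
     (\<forall>X\<in>milnor_piece f a. \<forall>Y\<in>milnor_piece f a. \<phi> (X + Y) = \<phi> X + \<phi> Y) \<and>
     (\<forall>c. \<forall>X\<in>milnor_piece f a. \<phi> (milnor_scale f a c X) = milnor_scale f b c (\<phi> X))"

text \<open>\<open>\<P>(W)\<close> as the set of lines in \<open>W\<close>.\<close>
definition proj :: "('n, 'k::field) mpoly set \<Rightarrow> ('n, 'k) mpoly set set" where
  "proj W = {mpoly_vs.span {w} | w. w \<in> W \<and> w \<noteq> 0}"

definition veronese :: "nat \<Rightarrow> ('n::finite, 'k::field) mpoly set set" where
  "veronese m = {mpoly_vs.span {l ^ m} | l. l \<in> homog 1 \<and> l \<noteq> 0}"

text \<open>The codimension of \<open>\<P>((J\<^sub>f)\<^sub>m)\<close> in \<open>\<P>(R\<^sub>m)\<close>.\<close>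
definition gradient_codim :: "('n::finite, 'k::field) mpoly \<Rightarrow> nat \<Rightarrow> int" where
  "gradient_codim f m =
     int (mpoly_vs.dim (homog m :: ('n, 'k) mpoly set)) - int (mpoly_vs.dim (gradient_piece f m))"

definition veronese_avoiding :: "nat \<Rightarrow> ('n::finite, 'k::field) mpoly \<Rightarrow> bool" where
  "veronese_avoiding d f \<longleftrightarrow>
     3 \<le> d \<and> f \<in> homog d \<and> squarefree f \<and>
     (let T = CARD('n) * (d - 2) in
        gradient_codim f (T - 1) = int CARD('n) \<and>
        proj (gradient_piece f (T - 1)) \<inter> veronese (T - 1) = {})"

text \<open>Zariski-open subsets of the affine space \<open>R\<^sub>1\<close>, with the coefficients of a linear
  form as coordinates: complements of common zero loci of sets of polynomials.\<close>
definition zariski_open_linear :: "('n::finite, 'k::field) mpoly set \<Rightarrow> bool" where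
  "zariski_open_linear U \<longleftrightarrow>
     (\<exists>S :: ('n, 'k) mpoly set. U = {l \<in> homog 1.
        \<exists>p\<in>S. meval (\<lambda>i. Poly_Mapping.lookup l (Poly_Mapping.single i 1)) p \<noteq> 0})"

end

theory Submission
  imports Defs "HOL-Analysis.Determinants" "HOL-Computational_Algebra.Polynomial_Factorial"
begin

text \<open>
  Put \<open>D = T - 1\<close> and \<open>W = (J\<^sub>f)\<^sub>D\<close>. By condition (I) the quotient \<open>R\<^sub>D / W\<close> has the same dimension
  \<open>n\<close> as \<open>R\<^sub>1\<close>. In coordinates on this quotient the map \<open>\<ell> \<mapsto> \<ell>\<^sup>D mod W\<close> consists of \<open>n\<close> forms
  \<open>g\<^sub>1, \<dots>, g\<^sub>n\<close> of degree \<open>D\<close> in the \<open>n\<close> coefficients of \<open>\<ell>\<close> (\<open>coefficients_of_power\<close>), and condition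
  (II) says that these forms have no common zero except the origin. The derivative of the map at
  \<open>\<ell>\<close> sends \<open>q \<in> R\<^sub>1\<close> to \<open>D \<ell>\<^bsup>D-1\<^esup> q\<close>, which is up to the nonzero factor \<open>D\<close> the multiplication map
  of the theorem. So this map is bijective wherever the Jacobian determinant of the \<open>g\<^sub>l\<close> does not
  vanish, and \<open>U\<close> is the set of these \<open>\<ell>\<close>. It is not empty, because the determinant is not the zero
  polynomial (\<open>jacobian_determinant_nonzero\<close>) and \<open>k\<close> is infinite.

  In geometric terms the last point holds because the \<open>g\<^sub>l\<close> define a finite, hence dominant, map
  from the projective space of dimension \<open>n - 1\<close> to itself, and dominant maps are generically smooth
  in characteristic zero. The proof below is algebraic. Let \<open>K\<close> be the field of rational functions in
  \<open>x\<^sub>1, \<dots>, x\<^sub>n\<close>. If the determinant were zero, a nonzero vector in the kernel of the Jacobian matrix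
  over \<open>K\<close> would give a nonzero derivation \<open>\<delta>\<close> from \<open>k[x\<^sub>1, \<dots>, x\<^sub>n]\<close> to \<open>K\<close> that kills every \<open>g\<^sub>l\<close>.
  Let \<open>C\<close> be the ring of polynomials killed by \<open>\<delta>\<close>.

  \<^item> If every \<open>x\<^sub>i\<close> is algebraic over \<open>C\<close>, differentiating a relation of minimal degree shows
    \<open>\<delta> x\<^sub>i = 0\<close> for all \<open>i\<close> (\<open>vector_field_zero_if_algebraic\<close>), so \<open>\<delta> = 0\<close>.

  \<^item> If some \<open>x\<^sub>i\<close> is transcendental over \<open>C\<close>, evaluation of \<open>C\<close> at the origin extends to a
    homomorphism on \<open>C[1/x\<^sub>i]\<close> with \<open>1/x\<^sub>i \<mapsto> 0\<close>, and further to a place of \<open>K\<close> with values in \<open>k\<close>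
    (\<open>place_extension\<close>). Let \<open>x\<^sub>j\<close> be a coordinate with a pole of maximal order, and \<open>a\<^sub>i\<close> the value of
    \<open>x\<^sub>i/x\<^sub>j\<close>. Then \<open>a\<^sub>j = 1\<close>, and \<open>g\<^sub>l(a)\<close> is the value of \<open>g\<^sub>l(x) (1/x\<^sub>j)\<^sup>D\<close>, which is \<open>0\<close> because
    \<open>g\<^sub>l(x) \<in> C\<close> has a finite value (\<open>common_zero_if_transcendental\<close>). This contradicts (II).
\<close>

section \<open>Evaluation and derivatives of polynomials\<close>

definition mvar :: "'n \<Rightarrow> ('n, 'k::field) mpoly" where
  "mvar i = Poly_Mapping.single (Poly_Mapping.single i 1) 1"

definition linear_form :: "('n::finite \<Rightarrow> 'k::field) \<Rightarrow> ('n, 'k) mpoly" where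
  "linear_form a = (\<Sum>i\<in>UNIV. Poly_Mapping.single (Poly_Mapping.single i 1) (a i))"

definition eval_via :: "('k::field \<Rightarrow> 'r::comm_ring_1) \<Rightarrow> ('n::finite \<Rightarrow> 'r) \<Rightarrow> ('n, 'k) mpoly \<Rightarrow> 'r" where
  "eval_via \<iota> x p = (\<Sum>m\<in>Poly_Mapping.keys p.
     \<iota> (Poly_Mapping.lookup p m) * (\<Prod>i\<in>UNIV. x i ^ Poly_Mapping.lookup m i))"

lemma mpoly_expansion:
  fixes p :: "('n, 'k::field) mpoly"
  shows "p = (\<Sum>m\<in>Poly_Mapping.keys p. Poly_Mapping.single m (Poly_Mapping.lookup p m))"
  by (rule poly_mapping_eqI)
     (simp add: lookup_sum lookup_single when_def in_keys_iff)

lemma mpoly_induct [case_names zero single add]: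
  fixes p :: "('n, 'k::field) mpoly"
  assumes "P 0" "\<And>m c. P (Poly_Mapping.single m c)" "\<And>p q. P p \<Longrightarrow> P q \<Longrightarrow> P (p + q)"
  shows "P p"
proof -
  have "P (\<Sum>m\<in>A. Poly_Mapping.single m (Poly_Mapping.lookup p m))" if "finite A" for A
    using that by induction (simp_all add: assms)
  from this[OF finite_keys[of p]] show ?thesis
    by (simp flip: mpoly_expansion)
qed

lemma prod_power_single:
  fixes x :: "'n::finite \<Rightarrow> 'r::comm_ring_1"
  shows "(\<Prod>j\<in>UNIV. x j ^ Poly_Mapping.lookup (Poly_Mapping.single i e) j) = x i ^ e"
proof -
  have "(\<Prod>j\<in>UNIV. x j ^ Poly_Mapping.lookup (Poly_Mapping.single i e) j)
      = (\<Prod>j\<in>UNIV. if j = i then x i ^ e else 1)"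
    by (intro prod.cong) (auto simp: lookup_single when_def)
  then show ?thesis by simp
qed

lemma mvar_power: "mvar i ^ e = Poly_Mapping.single (Poly_Mapping.single i e) 1"
  by (induction e) (simp_all add: mvar_def mult_single single_add[symmetric])

lemma monomial_eq_prod_mvar:
  fixes m :: "'n::finite \<Rightarrow>\<^sub>0 nat"
  shows "Poly_Mapping.single m c
    = Poly_Mapping.single 0 c * (\<Prod>i\<in>UNIV. mvar i ^ Poly_Mapping.lookup m i)"
proof -
  have "(\<Prod>i\<in>A. Poly_Mapping.single (Poly_Mapping.single i (Poly_Mapping.lookup m i)) 1)
      = Poly_Mapping.single (\<Sum>i\<in>A. Poly_Mapping.single i (Poly_Mapping.lookup m i)) (1::'a)"
    for A :: "'n set"
    by (induction A rule: infinite_finite_induct) (simp_all add: mult_single)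
  moreover have "(\<Sum>i\<in>UNIV. Poly_Mapping.single i (Poly_Mapping.lookup m i)) = m"
    by (rule poly_mapping_eqI) (simp add: lookup_sum lookup_single when_def)
  ultimately show ?thesis
    by (simp only: mvar_power mult_single) (simp add: mult_single)
qed

lemma mpoly_ring_induct [case_names const var add mult]:
  fixes p :: "('n::finite, 'k::field) mpoly"
  assumes const: "\<And>c. P (Poly_Mapping.single 0 c)" and var: "\<And>i. P (mvar i)"
    and add: "\<And>p q. P p \<Longrightarrow> P q \<Longrightarrow> P (p + q)" and mult: "\<And>p q. P p \<Longrightarrow> P q \<Longrightarrow> P (p * q)"
  shows "P p"
proof (induction p rule: mpoly_induct)
  case zero
  show ?case using const[of 0] by simp
next
  case (single m c)
  have one: "P 1" using const[of 1] by simp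
  have "P (mvar i ^ e)" for i e
    by (induction e) (simp_all add: var mult one)
  then have "P (\<Prod>i\<in>A. mvar i ^ Poly_Mapping.lookup m i)" for A
    by (induction A rule: infinite_finite_induct) (simp_all add: mult one)
  then show ?case
    by (subst monomial_eq_prod_mvar) (intro mult const)
qed (rule add)

lemma mdeg_add: "mdeg (m + m') = mdeg m + mdeg m'"
  by (simp add: mdeg_def lookup_add sum.distrib)

lemma mdeg_zero [simp]: "mdeg 0 = 0"
  by (simp add: mdeg_def)

lemma mdeg_single: "mdeg (Poly_Mapping.single i e) = e"
  by (simp add: mdeg_def lookup_single when_def)

lemma meval_eq_eval_via: "meval = eval_via (\<lambda>c. c)"
  by (intro ext) (simp add: meval_def eval_via_def)

locale coeff_hom =
  fixes \<iota> :: "'k::field \<Rightarrow> 'r::comm_ring_1"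
  assumes hom_add: "\<iota> (a + b) = \<iota> a + \<iota> b"
    and hom_mult: "\<iota> (a * b) = \<iota> a * \<iota> b"
    and hom_one: "\<iota> 1 = 1"
begin

lemma hom_zero: "\<iota> 0 = 0"
  using hom_add[of 0 0] by simp

lemma hom_uminus: "\<iota> (- a) = - \<iota> a"
  using hom_add[of a "- a"] by (simp add: hom_zero eq_neg_iff_add_eq_0 add.commute)

lemma hom_of_nat: "\<iota> (of_nat n) = of_nat n"
  by (induction n) (simp_all add: hom_zero hom_add hom_one)

lemma eval_via_superset:
  assumes "finite A" "Poly_Mapping.keys p \<subseteq> A"
  shows "eval_via \<iota> x p =
    (\<Sum>m\<in>A. \<iota> (Poly_Mapping.lookup p m) * (\<Prod>i\<in>UNIV. x i ^ Poly_Mapping.lookup m i))"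
  unfolding eval_via_def using assms
  by (intro sum.mono_neutral_left) (auto simp: in_keys_iff hom_zero)

lemma eval_via_zero [simp]: "eval_via \<iota> x 0 = 0"
  by (simp add: eval_via_def)

lemma eval_via_add: "eval_via \<iota> x (p + q) = eval_via \<iota> x p + eval_via \<iota> x q"
proof -
  let ?A = "Poly_Mapping.keys p \<union> Poly_Mapping.keys q"
  have "Poly_Mapping.keys (p + q) \<subseteq> ?A" by (rule keys_add)
  then show ?thesis
    by (simp add: eval_via_superset[of ?A] lookup_add hom_add ring_distribs sum.distrib)
qed

lemma eval_via_sum: "eval_via \<iota> x (sum p A) = (\<Sum>j\<in>A. eval_via \<iota> x (p j))"
  by (induction A rule: infinite_finite_induct) (simp_all add: eval_via_add)

lemma eval_via_single:
  "eval_via \<iota> x (Poly_Mapping.single m c) = \<iota> c * (\<Prod>i\<in>UNIV. x i ^ Poly_Mapping.lookup m i)"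
  by (subst eval_via_superset[of "{m}"]) (auto simp: keys_single hom_zero)

lemma eval_via_const [simp]: "eval_via \<iota> x (Poly_Mapping.single 0 c) = \<iota> c"
  by (simp add: eval_via_single)

lemma eval_via_one [simp]: "eval_via \<iota> x 1 = 1"
  using eval_via_const[of x 1] by (simp add: hom_one)

lemma eval_via_mvar [simp]: "eval_via \<iota> x (mvar i) = x i"
  using eval_via_single[of x "Poly_Mapping.single i 1" 1]
  by (simp only: mvar_def prod_power_single hom_one power_one_right mult_1)

lemma eval_via_mult: "eval_via \<iota> x (p * q) = eval_via \<iota> x p * eval_via \<iota> x q"
proof (induction p rule: mpoly_induct)
  case (single m c)
  show ?case
  proof (induction q rule: mpoly_induct)
    case (single m' c')
    show ?case
      by (simp add: mult_single eval_via_single hom_mult lookup_add power_add prod.distrib mult_ac)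
  qed (simp_all add: eval_via_add ring_distribs)
qed (simp_all add: eval_via_add ring_distribs)

lemma eval_via_uminus: "eval_via \<iota> x (- p) = - eval_via \<iota> x p"
  using eval_via_add[of x p "- p"] by (simp add: eq_neg_iff_add_eq_0 add.commute)

lemma eval_via_diff: "eval_via \<iota> x (p - q) = eval_via \<iota> x p - eval_via \<iota> x q"
  using eval_via_add[of x p "- q"] by (simp add: eval_via_uminus)

lemma eval_via_power: "eval_via \<iota> x (p ^ e) = eval_via \<iota> x p ^ e"
  by (induction e) (simp_all add: eval_via_mult)

lemma eval_via_prod: "eval_via \<iota> x (prod p A) = (\<Prod>j\<in>A. eval_via \<iota> x (p j))"
  by (induction A rule: infinite_finite_induct) (simp_all add: eval_via_mult)

lemma eval_via_of_int: "eval_via \<iota> x (of_int z) = of_int z"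
proof -
  have "eval_via \<iota> x (of_nat e) = of_nat e" for e
    by (induction e) (simp_all add: eval_via_add)
  then show ?thesis by (cases z) (simp_all add: eval_via_diff eval_via_uminus)
qed

lemma eval_via_homog:
  assumes "p \<in> homog e"
  shows "eval_via \<iota> (\<lambda>i. c * x i) p = c ^ e * eval_via \<iota> x p"
proof -
  have "(\<Prod>i\<in>UNIV. (c * x i) ^ Poly_Mapping.lookup m i)
      = c ^ e * (\<Prod>i\<in>UNIV. x i ^ Poly_Mapping.lookup m i)" if "m \<in> Poly_Mapping.keys p" for m
    using assms that
    by (simp add: power_mult_distrib prod.distrib homog_def mdeg_def flip: power_sum)
  then show ?thesis
    by (simp add: eval_via_def sum_distrib_left mult_ac)
qed

lemma eval_via_det:
  "eval_via \<iota> x (det A) = det (\<chi> i j. eval_via \<iota> x (A $ i $ j))"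
  for A :: "('n::finite, 'k) mpoly ^ 'm::finite ^ 'm"
  by (simp add: det_def eval_via_sum eval_via_mult eval_via_prod eval_via_of_int)

end

interpretation id_hom: coeff_hom "\<lambda>c::'k::field. c"
  by unfold_locales simp_all

lemma lookup_partial:
  "Poly_Mapping.lookup (partial i p) m
     = of_nat (Poly_Mapping.lookup m i + 1) * Poly_Mapping.lookup p (m + Poly_Mapping.single i 1)"
proof -
  let ?e = "Poly_Mapping.single i (1::nat)"
  let ?c = "\<lambda>m'. of_nat (Poly_Mapping.lookup m' i) * Poly_Mapping.lookup p m'"
  \<comment> \<open>Exponents that do not involve \<open>i\<close> may also satisfy \<open>m' - e = m\<close>, but they have coefficient \<open>0\<close>.\<close>
  have shift: "m' = m + ?e" if "m' - ?e = m" "Poly_Mapping.lookup m' i \<noteq> 0" for m'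
    unfolding that(1)[symmetric] using that(2)
    by (intro poly_mapping_eqI) (auto simp: lookup_add lookup_minus lookup_single when_def)
  have "(?c m' when m' - ?e = m) = (?c m' when m' = m + ?e)" for m'
  proof (cases "Poly_Mapping.lookup m' i = 0")
    case False
    then have "m' - ?e = m \<longleftrightarrow> m' = m + ?e"
      using shift by (metis add_diff_cancel_right')
    then show ?thesis by (simp only:)
  qed simp
  then have "Poly_Mapping.lookup (partial i p) m
      = (\<Sum>m'\<in>Poly_Mapping.keys p. ?c m' when m' = m + ?e)"
    by (simp add: partial_def lookup_sum lookup_single)
  also have "\<dots> = ?c (m + ?e)"
    by (simp add: when_def in_keys_iff)
  finally show ?thesis by (simp add: lookup_add)
qed

lemma partial_zero [simp]: "partial i 0 = 0"
  by (simp add: partial_def)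

lemma partial_add: "partial i (p + q) = partial i p + partial i q"
  by (rule poly_mapping_eqI) (simp add: lookup_partial lookup_add ring_distribs)

lemma partial_sum: "partial i (sum p A) = (\<Sum>j\<in>A. partial i (p j))"
  by (induction A rule: infinite_finite_induct) (simp_all add: partial_add)

lemma partial_single:
  "partial i (Poly_Mapping.single m c) =
     Poly_Mapping.single (m - Poly_Mapping.single i 1) (of_nat (Poly_Mapping.lookup m i) * c)"
  by (cases "c = 0") (simp_all add: partial_def)

lemma partial_const [simp]: "partial i (Poly_Mapping.single 0 c) = 0"
  by (simp add: partial_single)

lemma partial_mvar: "partial i (mvar j) = (if i = j then 1 else 0)"
  by (auto simp: mvar_def partial_single lookup_single when_def intro!: poly_mapping_eqI)

text \<open>The truncated subtraction of exponents is harmless: where it truncates, the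
  coefficient vanishes.\<close>
lemma single_minus_add:
  fixes m m' :: "'n \<Rightarrow>\<^sub>0 nat"
  shows "Poly_Mapping.single (m - Poly_Mapping.single i 1 + m') (of_nat (Poly_Mapping.lookup m i) * c)
    = Poly_Mapping.single (m + m' - Poly_Mapping.single i 1) (of_nat (Poly_Mapping.lookup m i) * c)"
proof (cases "Poly_Mapping.lookup m i = 0")
  case False
  then have "m - Poly_Mapping.single i 1 + m' = m + m' - Poly_Mapping.single i 1"
    by (intro poly_mapping_eqI) (auto simp: lookup_add lookup_minus lookup_single when_def)
  then show ?thesis by simp
qed simp

lemma partial_mult: "partial i (p * q) = partial i p * q + p * partial i q"
proof (induction p rule: mpoly_induct)
  case (single m c)
  show ?case
  proof (induction q rule: mpoly_induct)
    case (single m' c')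
    have "partial i (Poly_Mapping.single m c) * Poly_Mapping.single m' c'
        = Poly_Mapping.single (m + m' - Poly_Mapping.single i 1)
            (of_nat (Poly_Mapping.lookup m i) * (c * c'))"
      using single_minus_add[of m i m' "c * c'"]
      by (simp add: partial_single mult_single mult_ac add_ac)
    moreover have "Poly_Mapping.single m c * partial i (Poly_Mapping.single m' c')
        = Poly_Mapping.single (m + m' - Poly_Mapping.single i 1)
            (of_nat (Poly_Mapping.lookup m' i) * (c * c'))"
      using single_minus_add[of m' i m "c * c'"]
      by (simp add: partial_single mult_single mult_ac add_ac)
    ultimately show ?case
      by (simp add: mult_single partial_single lookup_add ring_distribs flip: single_add)
  qed (simp_all add: partial_add ring_distribs)
qed (simp_all add: partial_add ring_distribs)

interpretation const_poly: coeff_hom "\<lambda>c::'k::field. [:c:]"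
  by unfold_locales simp_all

text \<open>The chain rule along the line through \<open>a\<close> in the direction of the coordinate \<open>i\<close>. It
  connects partial derivatives with the values of the polynomial.\<close>
lemma pderiv_restrict_to_line:
  fixes a :: "'n::finite \<Rightarrow> 'k::field" and i :: 'n
  defines "L \<equiv> \<lambda>j. [:a j, if j = i then 1 else 0:]"
  shows "pderiv (eval_via (\<lambda>c. [:c:]) L p) = eval_via (\<lambda>c. [:c:]) L (partial i p)"
proof (induction p rule: mpoly_ring_induct)
  case (var j)
  show ?case
    by (simp add: L_def partial_mvar pderiv_pCons)
qed (simp_all add: const_poly.eval_via_add const_poly.eval_via_mult partial_add partial_mult
      pderiv_add pderiv_mult pderiv_pCons)

lemma poly_eval_via_const_poly:
  "poly (eval_via (\<lambda>c. [:c:]) x p) t = meval (\<lambda>i. poly (x i) t) p"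
  by (simp add: eval_via_def meval_def poly_sum poly_prod)

text \<open>Restriction to lines shows that the partial derivatives of a polynomial vanish as
  functions if the polynomial does, and in characteristic zero they determine the polynomial up
  to its constant term. This is an induction on the degree.\<close>
lemma mpoly_zero_of_function_zero:
  fixes p :: "('n::finite, 'k::field_char_0) mpoly"
  assumes "\<And>a. meval a p = 0"
  shows "p = 0"
proof -
  have "q = 0" if "\<forall>m\<in>Poly_Mapping.keys q. mdeg m \<le> e" "\<And>a. meval a q = 0"
    for q :: "('n, 'k) mpoly" and e
    using that
  proof (induction e arbitrary: q)
    case 0
    have "m = 0" if "m \<in> Poly_Mapping.keys q" for m
      using 0(1) that by (intro poly_mapping_eqI) (auto simp: mdeg_def)
    then have "q = Poly_Mapping.single 0 (Poly_Mapping.lookup q 0)"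
      by (intro poly_mapping_eqI) (auto simp: lookup_single when_def in_keys_iff)
    then show ?case
      using 0(2)[of "\<lambda>_. 0"] id_hom.eval_via_const[of "\<lambda>_. 0" "Poly_Mapping.lookup q 0"]
      by (metis meval_eq_eval_via single_zero)
  next
    case (Suc e)
    have "partial i q = 0" for i
    proof (rule Suc.IH)
      show "\<forall>m\<in>Poly_Mapping.keys (partial i q). mdeg m \<le> e"
      proof
        fix m assume "m \<in> Poly_Mapping.keys (partial i q)"
        then have "m + Poly_Mapping.single i 1 \<in> Poly_Mapping.keys q"
          by (auto simp: in_keys_iff lookup_partial)
        with Suc.prems(1) have "mdeg (m + Poly_Mapping.single i 1) \<le> Suc e" by blast
        then show "mdeg m \<le> e"
          by (simp add: mdeg_add mdeg_single)
      qed
      show "meval a (partial i q) = 0" for a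
      proof -
        let ?L = "\<lambda>j. [:a j, if j = i then 1 else 0:]"
        have "poly (eval_via (\<lambda>c. [:c:]) ?L q) t = 0" for t
          by (simp add: poly_eval_via_const_poly Suc.prems(2))
        then have "eval_via (\<lambda>c. [:c:]) ?L q = 0"
          using poly_all_0_iff_0 by blast
        then have "eval_via (\<lambda>c. [:c:]) ?L (partial i q) = 0"
          by (simp flip: pderiv_restrict_to_line)
        then have "poly (eval_via (\<lambda>c. [:c:]) ?L (partial i q)) 0 = 0" by simp
        then show ?thesis by (simp add: poly_eval_via_const_poly)
      qed
    qed
    then have *: "Poly_Mapping.lookup q (m + Poly_Mapping.single i 1) = 0" for m i
      using lookup_partial[of i q m] by (simp del: of_nat_Suc of_nat_add)
    have "m = 0" if "m \<in> Poly_Mapping.keys q" for m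
    proof (rule ccontr)
      assume "m \<noteq> 0"
      then obtain i where "Poly_Mapping.lookup m i \<noteq> 0"
        by (metis lookup_zero poly_mapping_eqI)
      then have "m = (m - Poly_Mapping.single i 1) + Poly_Mapping.single i 1"
        by (intro poly_mapping_eqI) (auto simp: lookup_add lookup_minus lookup_single when_def)
      with *[of "m - Poly_Mapping.single i 1" i] that show False by (simp add: in_keys_iff)
    qed
    then have "\<forall>m\<in>Poly_Mapping.keys q. mdeg m \<le> e"
      by (metis mdeg_zero le0)
    then show ?case
      by (rule Suc.IH) (rule Suc.prems(2))
  qed
  from this[of p "Max (mdeg ` Poly_Mapping.keys p)"] assms show ?thesis by simp
qed

section \<open>Extension of homomorphisms into an algebraically closed field\<close>

text \<open>A homomorphism from a subalgebra of \<open>K\<close> to \<open>k\<close> is encoded by its graph, a subalgebra of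
  \<open>K \<times> k\<close>. Extensions are then ordered by inclusion, which suits Zorn's lemma, and since the
  graph is closed under subtraction it is single-valued as soon as it is so at \<open>0\<close>.\<close>
definition subalgebra_graph :: "('k::field \<Rightarrow> 'K::field) \<Rightarrow> ('K \<times> 'k) set \<Rightarrow> bool" where
  "subalgebra_graph \<iota> G \<longleftrightarrow> (\<forall>c. (\<iota> c, c) \<in> G) \<and>
     (\<forall>a b a' b'. (a, b) \<in> G \<longrightarrow> (a', b') \<in> G \<longrightarrow> (a + a', b + b') \<in> G \<and> (a * a', b * b') \<in> G)"

definition hom_graph :: "('k::field \<Rightarrow> 'K::field) \<Rightarrow> ('K \<times> 'k) set \<Rightarrow> bool" where
  "hom_graph \<iota> G \<longleftrightarrow> subalgebra_graph \<iota> G \<and> (\<forall>c. (0, c) \<in> G \<longrightarrow> c = 0)"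

text \<open>The graph of the homomorphism that \<open>G\<close> induces on polynomials, coefficient by
  coefficient.\<close>
definition polys_over :: "('K::field \<times> 'k::field) set \<Rightarrow> ('K poly \<times> 'k poly) set" where
  "polys_over G = {(P, Q). \<forall>s. (coeff P s, coeff Q s) \<in> G}"

text \<open>The graph generated by \<open>G\<close> and the assignment \<open>y \<mapsto> c\<close>. It need not be single-valued.\<close>
definition adjoin :: "('K::field \<times> 'k::field) set \<Rightarrow> 'K \<Rightarrow> 'k \<Rightarrow> ('K \<times> 'k) set" where
  "adjoin G y c = (\<lambda>(P, Q). (poly P y, poly Q c)) ` polys_over G"

locale field_hom = coeff_hom \<iota> for \<iota> :: "'k::alg_closed_field \<Rightarrow> 'K::field"
begin

lemma graph_const: "subalgebra_graph \<iota> G \<Longrightarrow> (\<iota> c, c) \<in> G"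
  and graph_add: "subalgebra_graph \<iota> G \<Longrightarrow> (a, b) \<in> G \<Longrightarrow> (a', b') \<in> G \<Longrightarrow> (a + a', b + b') \<in> G"
  and graph_mult: "subalgebra_graph \<iota> G \<Longrightarrow> (a, b) \<in> G \<Longrightarrow> (a', b') \<in> G \<Longrightarrow> (a * a', b * b') \<in> G"
  by (auto simp: subalgebra_graph_def)

lemma graph_zero: "subalgebra_graph \<iota> G \<Longrightarrow> (0, 0) \<in> G"
  using graph_const[of G 0] by (simp add: hom_zero)

lemma graph_one: "subalgebra_graph \<iota> G \<Longrightarrow> (1, 1) \<in> G"
  using graph_const[of G 1] by (simp add: hom_one)

lemma graph_uminus: "subalgebra_graph \<iota> G \<Longrightarrow> (a, b) \<in> G \<Longrightarrow> (- a, - b) \<in> G"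
  using graph_mult[OF _ graph_const[of G "-1"], of a b] by (simp add: hom_uminus hom_one)

lemma graph_diff:
  "subalgebra_graph \<iota> G \<Longrightarrow> (a, b) \<in> G \<Longrightarrow> (a', b') \<in> G \<Longrightarrow> (a - a', b - b') \<in> G"
  using graph_add[of G a b "- a'" "- b'"] graph_uminus by simp

lemma graph_sum:
  assumes "subalgebra_graph \<iota> G" "\<And>s. s \<in> A \<Longrightarrow> (f s, g s) \<in> G"
  shows "(sum f A, sum g A) \<in> G"
  using assms(2) by (induction A rule: infinite_finite_induct)
    (auto intro: graph_add[OF assms(1)] graph_zero[OF assms(1)])

lemma graph_prod:
  assumes "subalgebra_graph \<iota> G" "\<And>s. s \<in> A \<Longrightarrow> (f s, g s) \<in> G"
  shows "(prod f A, prod g A) \<in> G"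
  using assms(2) by (induction A rule: infinite_finite_induct)
    (auto intro: graph_mult[OF assms(1)] graph_one[OF assms(1)])

lemma graph_power:
  assumes "subalgebra_graph \<iota> G" "(a, b) \<in> G"
  shows "(a ^ e, b ^ e) \<in> G"
  by (induction e) (auto intro: graph_mult[OF assms(1)] graph_one[OF assms(1)] assms(2))

lemma graph_eval:
  assumes "subalgebra_graph \<iota> G" "\<And>i. (u i, a i) \<in> G"
  shows "(eval_via \<iota> u p, meval a p) \<in> G"
  unfolding eval_via_def meval_def using assms
  by (intro graph_sum graph_mult graph_prod graph_power graph_const)

lemma hom_graph_unique:
  assumes "hom_graph \<iota> G" "(a, b) \<in> G" "(a, b') \<in> G"
  shows "b = b'"
  using assms graph_diff[of G a b a b'] by (auto simp: hom_graph_def)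

lemma polys_over_add:
  "subalgebra_graph \<iota> G \<Longrightarrow> (P, Q) \<in> polys_over G \<Longrightarrow> (P', Q') \<in> polys_over G
    \<Longrightarrow> (P + P', Q + Q') \<in> polys_over G"
  by (simp add: polys_over_def graph_add)

lemma polys_over_diff:
  "subalgebra_graph \<iota> G \<Longrightarrow> (P, Q) \<in> polys_over G \<Longrightarrow> (P', Q') \<in> polys_over G
    \<Longrightarrow> (P - P', Q - Q') \<in> polys_over G"
  by (simp add: polys_over_def graph_diff)

lemma polys_over_mult:
  "subalgebra_graph \<iota> G \<Longrightarrow> (P, Q) \<in> polys_over G \<Longrightarrow> (P', Q') \<in> polys_over G
    \<Longrightarrow> (P * P', Q * Q') \<in> polys_over G"
  by (simp add: polys_over_def coeff_mult graph_sum graph_mult)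

lemma polys_over_monom:
  "subalgebra_graph \<iota> G \<Longrightarrow> (a, b) \<in> G \<Longrightarrow> (monom a e, monom b e) \<in> polys_over G"
  by (simp add: polys_over_def graph_zero)

lemma polys_over_smult:
  "subalgebra_graph \<iota> G \<Longrightarrow> (a, b) \<in> G \<Longrightarrow> (P, Q) \<in> polys_over G
    \<Longrightarrow> (smult a P, smult b Q) \<in> polys_over G"
  by (simp add: polys_over_def graph_mult)

lemma polys_over_map_poly:
  "subalgebra_graph \<iota> G \<Longrightarrow> (map_poly \<iota> Q, Q) \<in> polys_over G"
  by (simp add: polys_over_def coeff_map_poly hom_zero graph_const)

lemma adjoin_subalgebra:
  assumes "subalgebra_graph \<iota> G"
  shows "subalgebra_graph \<iota> (adjoin G y c)" "G \<subseteq> adjoin G y c" "(y, c) \<in> adjoin G y c"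
proof -
  have intro: "(poly P y, poly Q c) \<in> adjoin G y c" if "(P, Q) \<in> polys_over G" for P Q
    using that by (force simp: adjoin_def)
  show sub: "G \<subseteq> adjoin G y c"
  proof
    fix x assume "x \<in> G"
    then have "(monom (fst x) 0, monom (snd x) 0) \<in> polys_over G"
      by (intro polys_over_monom assms) simp
    from intro[OF this] show "x \<in> adjoin G y c" by (simp add: poly_monom)
  qed
  show "(y, c) \<in> adjoin G y c"
    using intro[OF polys_over_monom[OF assms graph_one[OF assms], of 1]] by (simp add: poly_monom)
  show "subalgebra_graph \<iota> (adjoin G y c)"
    unfolding subalgebra_graph_def
  proof (intro conjI allI impI)
    show "(\<iota> c', c') \<in> adjoin G y c" for c'
      using sub graph_const[OF assms] by blast
    fix a b a' b' assume "(a, b) \<in> adjoin G y c" "(a', b') \<in> adjoin G y c"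
    then obtain P Q P' Q' where *: "(P, Q) \<in> polys_over G" "(P', Q') \<in> polys_over G"
      "a = poly P y" "b = poly Q c" "a' = poly P' y" "b' = poly Q' c"
      by (auto simp: adjoin_def)
    show "(a + a', b + b') \<in> adjoin G y c"
      using intro[OF polys_over_add[OF assms *(1,2)]] * by simp
    show "(a * a', b * b') \<in> adjoin G y c"
      using intro[OF polys_over_mult[OF assms *(1,2)]] * by simp
  qed
qed

lemma adjoin_hom_graph:
  assumes "subalgebra_graph \<iota> G"
    and "\<And>P Q. (P, Q) \<in> polys_over G \<Longrightarrow> poly P y = 0 \<Longrightarrow> poly Q c = 0"
  shows "hom_graph \<iota> (adjoin G y c)"
  using adjoin_subalgebra(1)[OF assms(1)] assms(2) by (auto simp: hom_graph_def adjoin_def)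

text \<open>The images in \<open>k[X]\<close> of the polynomial relations of \<open>y\<close> form an ideal. If it does not
  contain \<open>1\<close>, its generator has a root \<open>c\<close> in the algebraically closed field \<open>k\<close>, and \<open>c\<close> is a
  consistent value for \<open>y\<close>.\<close>
lemma extend_or_unit:
  fixes y :: 'K
  assumes "subalgebra_graph \<iota> G"
    and no_unit: "\<nexists>P. (P, 1) \<in> polys_over G \<and> poly P y = 0"
  shows "\<exists>c. hom_graph \<iota> (adjoin G y c)"
proof -
  let ?I = "{Q. \<exists>P. (P, Q) \<in> polys_over G \<and> poly P y = 0}"
  have mult: "R * Q \<in> ?I" if "Q \<in> ?I" for R Q
    using that polys_over_mult[OF assms(1) polys_over_map_poly[OF assms(1), of R]] by force
  have diff: "Q - Q' \<in> ?I" if "Q \<in> ?I" "Q' \<in> ?I" for Q Q'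
    using that polys_over_diff[OF assms(1)] by force
  have "\<exists>c. \<forall>Q\<in>?I. poly Q c = 0"
  proof (cases "?I \<subseteq> {0}")
    case True
    then have "poly Q 0 = 0" if "Q \<in> ?I" for Q using that by auto
    then show ?thesis by blast
  next
    case False
    then obtain Q0 where Q0: "Q0 \<in> ?I" "Q0 \<noteq> 0" by blast
    define Q1 where "Q1 = arg_min degree (\<lambda>Q. Q \<in> ?I \<and> Q \<noteq> 0)"
    have Q1: "Q1 \<in> ?I \<and> Q1 \<noteq> 0"
      unfolding Q1_def by (rule arg_min_natI) (use Q0 in blast)
    have min: "degree Q1 \<le> degree Q" if "Q \<in> ?I" "Q \<noteq> 0" for Q
      unfolding Q1_def by (rule arg_min_nat_le) (use that in blast)
    have "degree Q1 > 0"
    proof (rule ccontr)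
      assume "\<not> degree Q1 > 0"
      then obtain q where q: "Q1 = [:q:]" by (metis degree_eq_zeroE neq0_conv)
      with Q1 have "q \<noteq> 0" by auto
      with q have "[:inverse q:] * Q1 = 1" by (simp add: one_pCons)
      with mult[of Q1 "[:inverse q:]"] Q1 have "1 \<in> ?I" by metis
      with no_unit show False by blast
    qed
    then obtain c where c: "poly Q1 c = 0" using alg_closed_imp_poly_has_root by blast
    have "poly Q c = 0" if "Q \<in> ?I" for Q
    proof -
      have "Q mod Q1 = Q - Q div Q1 * Q1" by (simp add: minus_div_mult_eq_mod)
      moreover have "Q - Q div Q1 * Q1 \<in> ?I"
        by (rule diff[OF that mult]) (use Q1 in blast)
      ultimately have mem: "Q mod Q1 \<in> ?I" by (simp only:)
      have "Q mod Q1 = 0"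
      proof (rule ccontr)
        assume ne: "Q mod Q1 \<noteq> 0"
        with Q1 have "degree (Q mod Q1) < degree Q1" using degree_mod_less by blast
        with min[OF mem ne] show False by linarith
      qed
      then have "Q1 dvd Q" by auto
      with c show ?thesis by (auto simp: dvd_def)
    qed
    then show ?thesis by blast
  qed
  then obtain c where "\<And>Q. Q \<in> ?I \<Longrightarrow> poly Q c = 0" by blast
  then show ?thesis
    using adjoin_hom_graph[OF assms(1), of y c] by blast
qed

lemma reflect_relation:
  fixes y :: 'K
  assumes "degree R \<le> e" "y \<noteq> 0" "poly R (inverse y) = 0"
  shows "poly (\<Sum>s\<le>e. monom (coeff R s) (e - s)) y = 0"
proof -
  have "poly (\<Sum>s\<le>e. monom (coeff R s) (e - s)) y = (\<Sum>s\<le>e. coeff R s * y ^ (e - s))"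
    by (simp add: poly_sum poly_monom)
  also have "\<dots> = (\<Sum>s\<le>e. y ^ e * (coeff R s * inverse y ^ s))"
    using assms(2) by (intro sum.cong) (simp_all add: power_diff power_inverse field_simps)
  also have "\<dots> = y ^ e * (\<Sum>s\<le>e. coeff R s * inverse y ^ s)"
    by (simp add: sum_distrib_left)
  also have "(\<Sum>s\<le>e. coeff R s * inverse y ^ s) = poly R (inverse y)"
    unfolding poly_altdef using assms(1)
    by (intro sum.mono_neutral_right) (auto simp: coeff_eq_0)
  finally show ?thesis using assms(3) by simp
qed

text \<open>The relation of larger degree can be shortened with the other one: after reflection
  the latter has a leading coefficient of value \<open>1\<close> and all other coefficients of value \<open>0\<close>.\<close>
lemma shorten_relation:
  fixes y :: 'K
  assumes G: "subalgebra_graph \<iota> G" and y: "y \<noteq> 0"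
    and P: "(P, 1) \<in> polys_over G" "poly P y = 0" "degree P \<le> N"
    and R: "(R, 1) \<in> polys_over G" "poly R (inverse y) = 0" "degree R \<le> M"
    and MN: "M \<le> N" "0 < N"
  shows "\<exists>P'. (P', 1) \<in> polys_over G \<and> poly P' y = 0 \<and> degree P' \<le> N - 1"
proof -
  have P_coeff: "(coeff P s, coeff 1 s) \<in> G" and R_coeff: "(coeff R s, coeff 1 s) \<in> G" for s
    using P(1) R(1) by (simp_all only: polys_over_def mem_Collect_eq case_prod_conv)
  \<comment> \<open>The reflection \<open>X\<^sup>N R(1/X)\<close>.\<close>
  define S where "S = (\<Sum>s\<le>N. monom (coeff R s) (N - s))"
  have coeff_S: "coeff S t = (if t \<le> N then coeff R (N - t) else 0)" for t
  proof -
    have "coeff S t = (\<Sum>s\<le>N. if N - s = t then coeff R s else 0)"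
      by (simp add: S_def coeff_sum)
    also have "\<dots> = (\<Sum>s\<le>N. if s = N - t \<and> t \<le> N then coeff R s else 0)"
      by (intro sum.cong) auto
    also have "\<dots> = (if t \<le> N then coeff R (N - t) else 0)"
      by (cases "t \<le> N") simp_all
    finally show ?thesis .
  qed
  have S: "(S, monom 1 N) \<in> polys_over G"
    unfolding polys_over_def mem_Collect_eq case_prod_conv
  proof
    fix t
    show "(coeff S t, coeff (monom 1 N) t) \<in> G"
      using R_coeff[of "N - t"] graph_zero[OF G]
      by (cases t N rule: linorder_cases) (simp_all add: coeff_S)
  qed
  have S_root: "poly S y = 0"
    unfolding S_def using reflect_relation[of R N y] R MN y by simp
  \<comment> \<open>The leading coefficient of \<open>S\<close> is \<open>coeff R 0\<close>, so that the terms of degree \<open>N\<close> cancel; the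
    subtracted term has value \<open>0\<close> because \<open>coeff P N\<close> has.\<close>
  define P' where "P' = smult (coeff R 0) P - smult (coeff P N) S"
  have "(P', smult 1 1 - smult 0 (monom 1 N)) \<in> polys_over G"
    unfolding P'_def using R_coeff[of 0] P_coeff[of N] MN
    by (intro polys_over_diff polys_over_smult G P S) simp_all
  moreover have "poly P' y = 0"
    by (simp add: P'_def P S_root)
  moreover have "degree P' \<le> N - 1"
  proof (rule degree_le, intro allI impI)
    fix s assume "N - 1 < s"
    then consider "s = N" | "N < s" by linarith
    then show "coeff P' s = 0"
      using P(3) by cases (auto simp: P'_def coeff_S coeff_eq_0)
  qed
  ultimately show ?thesis by (auto simp flip: one_pCons)
qed

text \<open>Shortening the longer of the two relations again and again ends with a constant relation, which would
  give \<open>0\<close> the value \<open>1\<close>.\<close>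
lemma no_two_relations:
  fixes y :: 'K
  assumes G: "hom_graph \<iota> G" and "y \<noteq> 0"
    and "(P, 1) \<in> polys_over G" "poly P y = 0" "degree P \<le> N"
    and "(R, 1) \<in> polys_over G" "poly R (inverse y) = 0" "degree R \<le> M"
  shows False
  using assms(2-)
proof (induction "N + M" arbitrary: N M P R y rule: less_induct)
  case less
  have G': "subalgebra_graph \<iota> G" using G by (simp add: hom_graph_def)
  have triv: False if "(P, 1) \<in> polys_over G" "poly P z = 0" "degree P \<le> 0" for P and z :: 'K
  proof -
    from that(3) obtain a where "P = [:a:]" by (metis degree_eq_zeroE le_0_eq)
    with that(2) have "P = 0" by simp
    with that(1) have "(0, 1) \<in> G" by (simp add: polys_over_def) (metis of_bool_eq(2))
    with G show False by (auto simp: hom_graph_def)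
  qed
  show False
  proof (cases "N = 0 \<or> M = 0")
    case True
    then show False using triv less.prems by blast
  next
    case False
    show False
    proof (cases "M \<le> N")
      case True
      then obtain P' where "(P', 1) \<in> polys_over G" "poly P' y = 0" "degree P' \<le> N - 1"
        using shorten_relation[OF G' less.prems, of] False by auto
      then show False
        using less.hyps[of "N - 1" M y P' R] less.prems False by auto
    next
      case M: False
      then obtain R' where "(R', 1) \<in> polys_over G" "poly R' (inverse y) = 0" "degree R' \<le> M - 1"
        using shorten_relation[OF G', of "inverse y" R M P N] less.prems False by auto
      then show False
        using less.hyps[of N "M - 1" y P R'] less.prems False by auto
    qed
  qed
qed

text \<open>The second condition says that the elements with a value form a valuation ring of \<open>K\<close>.\<close>
definition is_place :: "('K \<times> 'k) set \<Rightarrow> bool" where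
  "is_place G \<longleftrightarrow> hom_graph \<iota> G \<and> (\<forall>y. y \<noteq> 0 \<longrightarrow> (\<exists>c. (y, c) \<in> G) \<or> (\<exists>c. (inverse y, c) \<in> G))"

text \<open>A maximal extension exists by Zorn's lemma. An element without a value satisfies a relation
  that is mapped to \<open>1\<close>, as it could be adjoined otherwise; but an element and its inverse
  cannot both satisfy such a relation.\<close>
theorem place_extension:
  assumes G0: "hom_graph \<iota> G0"
  shows "\<exists>G. is_place G \<and> G0 \<subseteq> G"
proof -
  let ?A = "{G. hom_graph \<iota> G \<and> G0 \<subseteq> G}"
  have "\<exists>M\<in>?A. \<forall>X\<in>?A. M \<subseteq> X \<longrightarrow> X = M"
  proof (rule subset_Zorn_nonempty)
    show "?A \<noteq> {}" using G0 by blast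
    fix \<C> assume \<C>: "\<C> \<noteq> {}" "subset.chain ?A \<C>"
    then have mem: "hom_graph \<iota> G" "G0 \<subseteq> G" if "G \<in> \<C>" for G
      using that by (auto simp: subset_chain_def)
    then have sub: "subalgebra_graph \<iota> G" if "G \<in> \<C>" for G
      using that by (auto simp: hom_graph_def)
    have "subalgebra_graph \<iota> (\<Union>\<C>)"
      unfolding subalgebra_graph_def
    proof (intro conjI allI impI)
      show "(\<iota> c, c) \<in> \<Union>\<C>" for c using \<C>(1) sub graph_const by blast
      fix a b a' b' assume "(a, b) \<in> \<Union>\<C>" "(a', b') \<in> \<Union>\<C>"
      then obtain G G' where GG: "G \<in> \<C>" "(a, b) \<in> G" "G' \<in> \<C>" "(a', b') \<in> G'" by blast
      with \<C>(2) have "G \<subseteq> G' \<or> G' \<subseteq> G" by (auto simp: subset_chain_def)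
      with GG obtain H where H: "H \<in> \<C>" "(a, b) \<in> H" "(a', b') \<in> H" by blast
      then show "(a + a', b + b') \<in> \<Union>\<C>" "(a * a', b * b') \<in> \<Union>\<C>"
        using graph_add[OF sub[OF H(1)] H(2,3)] graph_mult[OF sub[OF H(1)] H(2,3)] by blast+
    qed
    then have "hom_graph \<iota> (\<Union>\<C>)"
      using mem(1) by (auto simp: hom_graph_def)
    then show "\<Union>\<C> \<in> ?A" using mem(2) \<C>(1) by blast
  qed
  then obtain G where "G \<in> ?A" and maximal: "\<forall>X\<in>?A. G \<subseteq> X \<longrightarrow> X = G" by (rule bexE)
  then have G: "hom_graph \<iota> G" "G0 \<subseteq> G" by simp_all
  have max: "X = G" if "hom_graph \<iota> X" "G0 \<subseteq> X" "G \<subseteq> X" for X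
    using maximal that by simp
  have G': "subalgebra_graph \<iota> G" using G by (simp add: hom_graph_def)
  have in_domain: "\<exists>c. (z, c) \<in> G" if no_relation: "\<nexists>P. (P, 1) \<in> polys_over G \<and> poly P z = 0" for z
  proof -
    obtain c where "hom_graph \<iota> (adjoin G z c)"
      using extend_or_unit[OF G' no_relation] by blast
    moreover have "G \<subseteq> adjoin G z c" "(z, c) \<in> adjoin G z c"
      using adjoin_subalgebra(2,3)[OF G'] by simp_all
    ultimately have "(z, c) \<in> G"
      using max[of "adjoin G z c"] subset_trans[OF G(2)] by simp
    then show ?thesis ..
  qed
  have "is_place G"
    unfolding is_place_def using G(1) in_domain no_two_relations[OF G(1)] by (meson order.refl)
  with G(2) show ?thesis by blast
qed

text \<open>Divisibility with respect to a valuation ring is a total preorder, so a finite family has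
  an element that divides all others.\<close>
lemma place_dominant:
  assumes "is_place G" "finite A" "i0 \<in> A" "u i0 \<noteq> 0"
  shows "\<exists>j\<in>A. u j \<noteq> 0 \<and> (\<forall>i\<in>A. \<exists>c. (u i / u j, c) \<in> G)"
proof -
  have G: "subalgebra_graph \<iota> G" using assms(1) by (simp add: is_place_def hom_graph_def)
  have "\<exists>j\<in>B. u j \<noteq> 0 \<and> (\<forall>i\<in>B. \<exists>c. (u i / u j, c) \<in> G)"
    if "finite B" "\<exists>i\<in>B. u i \<noteq> 0" for B
    using that
  proof (induction B)
    case (insert b B)
    show ?case
    proof (cases "\<exists>i\<in>B. u i \<noteq> 0")
      case True
      then obtain j where j: "j \<in> B" "u j \<noteq> 0" "\<And>i. i \<in> B \<Longrightarrow> \<exists>c. (u i / u j, c) \<in> G"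
        using insert.IH by blast
      show ?thesis
      proof (cases "\<exists>c. (u b / u j, c) \<in> G")
        case True
        with j show ?thesis by (intro bexI[of _ j]) auto
      next
        case False
        then have b: "u b \<noteq> 0" using graph_zero[OF G] by force
        with False j(2) assms(1) obtain c where c: "(u j / u b, c) \<in> G"
          unfolding is_place_def by (metis divide_eq_0_iff inverse_divide)
        have "\<exists>c. (u i / u b, c) \<in> G" if "i \<in> B" for i
        proof -
          from j(3)[OF that] obtain c' where "(u i / u j, c') \<in> G" by blast
          from graph_mult[OF G this c] j(2) show ?thesis by auto
        qed
        moreover have "(u b / u b, 1) \<in> G" using b graph_one[OF G] by simp
        ultimately show ?thesis using b by (intro bexI[of _ b]) auto
      qed
    next
      case False
      with insert.prems have "u b \<noteq> 0" by auto
      with False show ?thesis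
        using graph_one[OF G] graph_zero[OF G] by (intro bexI[of _ b]) auto
    qed
  qed simp
  from this[of A] assms show ?thesis by blast
qed

end

section \<open>The Jacobian determinant of forms without a common zero\<close>

text \<open>The \<open>x i\<close> are algebraically independent over \<open>k\<close>: they play the role of the variables in
  the field of rational functions.\<close>
locale generic_point = field_hom \<iota> for \<iota> :: "'k::{alg_closed_field,field_char_0} \<Rightarrow> 'K::field" +
  fixes x :: "'n::finite \<Rightarrow> 'K"
  assumes generic: "eval_via \<iota> x p = 0 \<Longrightarrow> p = 0"
begin

abbreviation E :: "('n, 'k) mpoly \<Rightarrow> 'K" where
  "E \<equiv> eval_via \<iota> x"

lemma hom_eq_zero: "\<iota> c = 0 \<Longrightarrow> c = 0"
  using generic[of "Poly_Mapping.single 0 c"] by (metis eval_via_const lookup_single_eq lookup_zero)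

lemma of_nat_nonzero: "e > 0 \<Longrightarrow> (of_nat e :: 'K) \<noteq> 0"
  using hom_eq_zero[of "of_nat e"] by (auto simp: hom_of_nat)

lemma coordinate_nonzero: "x i \<noteq> 0"
proof
  assume "x i = 0"
  then have "mvar i = (0 :: ('n, 'k) mpoly)" using generic[of "mvar i"] by simp
  then show False
    by (metis mvar_def lookup_single_eq lookup_zero zero_neq_one)
qed

text \<open>The derivation from the polynomial ring to \<open>K\<close> that sends the variable \<open>j\<close> to \<open>v j\<close>.\<close>
definition vector_field :: "('n \<Rightarrow> 'K) \<Rightarrow> ('n, 'k) mpoly \<Rightarrow> 'K" where
  "vector_field v p = (\<Sum>j\<in>UNIV. v j * E (partial j p))"

lemma vector_field_add: "vector_field v (p + q) = vector_field v p + vector_field v q"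
  by (simp add: vector_field_def partial_add eval_via_add ring_distribs sum.distrib)

lemma vector_field_zero: "vector_field v 0 = 0"
  by (simp add: vector_field_def)

lemma vector_field_sum: "vector_field v (sum f A) = (\<Sum>s\<in>A. vector_field v (f s))"
  by (induction A rule: infinite_finite_induct)
     (simp_all add: vector_field_add vector_field_zero)

lemma vector_field_mult:
  "vector_field v (p * q) = vector_field v p * E q + E p * vector_field v q"
  by (simp add: vector_field_def partial_mult eval_via_add eval_via_mult ring_distribs
      sum.distrib sum_distrib_left mult_ac)

lemma vector_field_const [simp]: "vector_field v (Poly_Mapping.single 0 c) = 0"
  by (simp add: vector_field_def)

lemma vector_field_mvar: "vector_field v (mvar i) = v i"
proof -
  have "vector_field v (mvar i) = (\<Sum>j\<in>UNIV. if j = i then v j else 0)"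
    unfolding vector_field_def by (intro sum.cong) (simp_all add: partial_mvar)
  then show ?thesis by simp
qed

lemma vector_field_mvar_power:
  "vector_field v (mvar i ^ e) = of_nat e * x i ^ (e - 1) * v i"
proof (induction e)
  case 0
  show ?case using vector_field_const[of v 1] by simp
next
  case (Suc e)
  then show ?case
    by (cases e) (simp_all add: vector_field_mult vector_field_mvar eval_via_power eval_via_mult algebra_simps)
qed

definition constants :: "('n \<Rightarrow> 'K) \<Rightarrow> 'K set" where
  "constants v = {E p | p. vector_field v p = 0}"

lemma constants_of_nat_mult: "c \<in> constants v \<Longrightarrow> of_nat e * c \<in> constants v"
proof -
  assume "c \<in> constants v"
  then obtain p where p: "vector_field v p = 0" "c = E p" by (auto simp: constants_def)
  have "vector_field v (Poly_Mapping.single 0 (of_nat e) * p) = 0"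
    by (simp only: vector_field_mult vector_field_const p(1)) simp
  moreover have "E (Poly_Mapping.single 0 (of_nat e) * p) = of_nat e * c"
    by (simp only: eval_via_mult eval_via_const hom_of_nat p(2))
  ultimately show ?thesis unfolding constants_def by (metis (mono_tags, lifting) mem_Collect_eq)
qed

text \<open>Apply the derivation to the relation \<open>P (x i) = 0\<close>. The coefficients are constants, so
  only the powers of \<open>x i\<close> contribute.\<close>
lemma derivative_of_relation:
  assumes "\<And>s. coeff P s \<in> constants v" "poly P (x i) = 0"
  shows "poly (pderiv P) (x i) * v i = 0"
proof -
  have "\<exists>p. vector_field v p = 0 \<and> coeff P s = E p" for s
    using assms(1)[of s] by (auto simp: constants_def)
  then obtain c where c: "\<And>s. vector_field v (c s) = 0" "\<And>s. coeff P s = E (c s)"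
    by metis
  \<comment> \<open>The relation is lifted to the polynomial ring, where the derivation is defined.\<close>
  define q where "q = (\<Sum>s\<le>degree P. c s * mvar i ^ s)"
  have "E q = poly P (x i)"
    by (simp add: q_def eval_via_sum eval_via_mult eval_via_power poly_altdef c(2))
  then have "vector_field v q = 0"
    using generic[of q] assms(2) by (simp add: vector_field_zero)
  have "vector_field v q = (\<Sum>s\<le>degree P. coeff P s * (of_nat s * x i ^ (s - 1) * v i))"
    by (simp add: q_def vector_field_sum vector_field_mult vector_field_mvar_power c)
  moreover have "poly (pderiv P) (x i) = (\<Sum>s\<le>degree P. of_nat s * coeff P s * x i ^ (s - 1))"
  proof -
    have "pderiv P = pderiv (\<Sum>s\<le>degree P. monom (coeff P s) s)"
      by (simp add: poly_as_sum_of_monoms)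
    also have "\<dots> = (\<Sum>s\<le>degree P. pderiv (monom (coeff P s) s))"
      using higher_pderiv_sum[of 1] by simp
    finally show ?thesis
      by (simp add: pderiv_monom poly_sum poly_monom)
  qed
  ultimately have "poly (pderiv P) (x i) * v i = vector_field v q"
    by (simp add: sum_distrib_left mult_ac)
  with \<open>vector_field v q = 0\<close> show ?thesis by simp
qed

text \<open>Descent on the degree of the relation. In characteristic zero the derivative of a
  non-constant relation is nonzero, so a relation of minimal degree has a derivative that
  does not vanish at \<open>x i\<close>.\<close>
lemma vector_field_zero_if_algebraic:
  assumes "P \<noteq> 0" "\<And>s. coeff P s \<in> constants v" "poly P (x i) = 0"
  shows "v i = 0"
  using assms
proof (induction "degree P" arbitrary: P rule: less_induct)
  case less
  show ?case
  proof (cases "poly (pderiv P) (x i) = 0")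
    case False
    with derivative_of_relation[OF less.prems(2,3)] show ?thesis by simp
  next
    case True
    have "degree P > 0"
    proof (rule ccontr)
      assume "\<not> degree P > 0"
      then obtain c where "P = [:c:]" by (metis degree_eq_zeroE neq0_conv)
      with less.prems show False by simp
    qed
    then have "coeff (pderiv P) (degree P - 1) \<noteq> 0"
      using of_nat_nonzero[of "degree P"] less.prems(1) by (simp add: coeff_pderiv del: of_nat_Suc)
    then have "pderiv P \<noteq> 0" by auto
    moreover have "degree (pderiv P) < degree P"
    proof -
      have "degree (pderiv P) \<le> degree P - 1"
        by (rule degree_le) (auto simp: coeff_pderiv coeff_eq_0)
      with \<open>degree P > 0\<close> show ?thesis by linarith
    qed
    moreover have "coeff (pderiv P) s \<in> constants v" for s
      unfolding coeff_pderiv by (intro constants_of_nat_mult less.prems(2))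
    ultimately show ?thesis using less.hyps True by blast
  qed
qed

text \<open>Evaluation at the origin, restricted to the constants.\<close>
definition constants_graph :: "('n \<Rightarrow> 'K) \<Rightarrow> ('K \<times> 'k) set" where
  "constants_graph v = {(E p, meval (\<lambda>_. 0) p) | p. vector_field v p = 0}"

lemma constants_graph_subalgebra: "subalgebra_graph \<iota> (constants_graph v)"
  unfolding subalgebra_graph_def
proof (intro conjI allI impI)
  show "(\<iota> c, c) \<in> constants_graph v" for c
    unfolding constants_graph_def mem_Collect_eq
    by (rule exI[of _ "Poly_Mapping.single 0 c"])
       (simp only: eval_via_const vector_field_const meval_eq_eval_via id_hom.eval_via_const)
  fix a b a' b' assume "(a, b) \<in> constants_graph v" "(a', b') \<in> constants_graph v"
  then obtain p q where pq: "vector_field v p = 0" "vector_field v q = 0"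
    and eq: "a = E p" "b = meval (\<lambda>_. 0) p" "a' = E q" "b' = meval (\<lambda>_. 0) q"
    by (auto simp: constants_graph_def)
  show "(a + a', b + b') \<in> constants_graph v"
    unfolding constants_graph_def mem_Collect_eq
    by (rule exI[of _ "p + q"])
       (simp add: eq pq eval_via_add vector_field_add meval_eq_eval_via id_hom.eval_via_add)
  show "(a * a', b * b') \<in> constants_graph v"
    unfolding constants_graph_def mem_Collect_eq
    by (rule exI[of _ "p * q"])
       (simp add: eq pq eval_via_mult vector_field_mult meval_eq_eval_via id_hom.eval_via_mult)
qed

lemma constants_graph_fst: "(a, b) \<in> constants_graph v \<Longrightarrow> a \<in> constants v"
  by (auto simp: constants_graph_def constants_def)

lemma constants_zero: "0 \<in> constants v"
  using constants_graph_fst[OF graph_zero[OF constants_graph_subalgebra]] .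

text \<open>Transcendence leaves the value of \<open>1 / x i\<close> over the constants free, and the choice \<open>0\<close>
  gives the point \<open>x\<close> a limit at infinity: the values of the ratios of the coordinates to a
  dominant one are the homogeneous coordinates of this limit. A form among the constants stays
  finite along the way, hence vanishes there.\<close>
lemma common_zero_if_transcendental:
  assumes trans: "\<And>P. P \<noteq> 0 \<Longrightarrow> (\<And>s. coeff P s \<in> constants v) \<Longrightarrow> poly P (x i) \<noteq> 0"
    and "D > 0"
  shows "\<exists>a. a \<noteq> (\<lambda>_. 0) \<and> (\<forall>p\<in>homog D. vector_field v p = 0 \<longrightarrow> meval a p = 0)"
proof -
  let ?G0 = "constants_graph v"
  \<comment> \<open>A relation of \<open>1 / x i\<close> becomes one of \<open>x i\<close> by reflection, so it is trivial.\<close>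
  have "poly Q 0 = 0" if PQ: "(P, Q) \<in> polys_over ?G0" and root: "poly P (inverse (x i)) = 0" for P Q
  proof -
    have PQ': "(coeff P s, coeff Q s) \<in> ?G0" for s
      using PQ by (simp add: polys_over_def)
    have "coeff (reflect_poly P) s \<in> constants v" for s
      using constants_graph_fst[OF PQ'] constants_zero by (simp add: coeff_reflect_poly)
    moreover have "poly (reflect_poly P) (x i) = 0"
      using root by (simp add: poly_reflect_poly_nz coordinate_nonzero)
    ultimately have "P = 0" using trans[of "reflect_poly P"] by auto
    with PQ'[of 0] obtain p where "E p = 0" "coeff Q 0 = meval (\<lambda>_. 0) p"
      by (auto simp: constants_graph_def)
    with generic[of p] show ?thesis by (simp add: poly_0_coeff_0 meval_def)
  qed
  then have "hom_graph \<iota> (adjoin ?G0 (inverse (x i)) 0)"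
    by (rule adjoin_hom_graph[OF constants_graph_subalgebra])
  then obtain G where place: "is_place G" and "adjoin ?G0 (inverse (x i)) 0 \<subseteq> G"
    using place_extension by blast
  then have G0: "?G0 \<subseteq> G" and pole: "(inverse (x i), 0) \<in> G"
    using adjoin_subalgebra[OF constants_graph_subalgebra, where y = "inverse (x i)" and c = 0]
    by blast+
  have G: "hom_graph \<iota> G" and G': "subalgebra_graph \<iota> G"
    using place by (simp_all add: is_place_def hom_graph_def)
  obtain j where "x j \<noteq> 0" "\<forall>l. \<exists>c. (x l / x j, c) \<in> G"
    using place_dominant[OF place finite_class.finite_UNIV, of i x] coordinate_nonzero by auto
  then obtain a where a: "\<And>l. (x l / x j, a l) \<in> G" by metis
  have "a j = 1"
    using hom_graph_unique[OF G a[of j], of 1] graph_one[OF G'] coordinate_nonzero by simp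
  then have "a \<noteq> (\<lambda>_. 0)" by (metis zero_neq_one)
  \<comment> \<open>\<open>1 / x j\<close> is the product of \<open>1 / x i\<close>, which has the value \<open>0\<close>, and \<open>x i / x j\<close>.\<close>
  moreover have inv: "(inverse (x j), 0) \<in> G"
    using graph_mult[OF G' pole a[of i]] coordinate_nonzero[of i] by (simp add: field_simps)
  have "meval a p = 0" if p: "p \<in> homog D" "vector_field v p = 0" for p
  proof -
    have "(E p, meval (\<lambda>_. 0) p) \<in> G"
      using G0 p(2) by (auto simp: constants_graph_def)
    from graph_mult[OF G' graph_power[OF G' inv, of D] this]
    have "(inverse (x j) ^ D * E p, 0) \<in> G"
      using \<open>D > 0\<close> by (simp add: zero_power)
    moreover have "(eval_via \<iota> (\<lambda>l. inverse (x j) * x l) p, meval a p) \<in> G"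
      using a by (intro graph_eval[OF G']) (simp add: divide_inverse mult.commute)
    ultimately show ?thesis
      using hom_graph_unique[OF G] by (metis eval_via_homog[OF p(1)])
  qed
  ultimately show ?thesis by blast
qed

lemma no_vector_field_kills_forms:
  fixes g :: "'l \<Rightarrow> ('n, 'k) mpoly"
  assumes "\<And>l. g l \<in> homog D" "D > 0"
    and "\<And>a. (\<And>l. meval a (g l) = 0) \<Longrightarrow> a = (\<lambda>_. 0)"
    and "\<And>l. vector_field v (g l) = 0"
  shows "v i = 0"
  using vector_field_zero_if_algebraic[of _ v i] common_zero_if_transcendental[of v i D] assms
  by metis

end

text \<open>The field is the fraction field of a polynomial ring. Numbering the variables by natural
  numbers orders the monomials linearly, so that leading terms show this ring to be an integral
  domain.\<close>
lemma generic_point_exists: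
  "\<exists>(\<iota> :: 'k::{alg_closed_field,field_char_0} \<Rightarrow> (nat, 'k) mpoly fract) (x :: 'n::finite \<Rightarrow> _).
     generic_point \<iota> x"
proof -
  obtain \<phi> :: "'n \<Rightarrow> nat" where inj: "inj \<phi>"
    using finite_imp_inj_to_nat_seg[OF finite_class.finite_UNIV] by blast
  let ?\<iota> = "\<lambda>c. to_fract (Poly_Mapping.single 0 c :: (nat, 'k) mpoly)"
  let ?x = "\<lambda>i. to_fract (mvar (\<phi> i) :: (nat, 'k) mpoly)"
  let ?emb = "\<lambda>m. \<Sum>i\<in>UNIV. Poly_Mapping.single (\<phi> i) (Poly_Mapping.lookup m i)"
  have hom: "coeff_hom ?\<iota>"
    by unfold_locales (simp_all add: single_add mult_single flip: to_fract_mult)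
  interpret coeff_hom ?\<iota> by (rule hom)
  have lookup_emb: "Poly_Mapping.lookup (?emb m) (\<phi> i) = Poly_Mapping.lookup m i" for m i
    using inj by (simp add: lookup_sum lookup_single when_def inj_eq)
  have inj_emb: "?emb m = ?emb m' \<longleftrightarrow> m = m'" for m m'
    using lookup_emb by (metis poly_mapping_eqI)
  have to_fract_power: "to_fract y ^ e = to_fract (y ^ e)" for y :: "(nat, 'k) mpoly" and e
    by (induction e) simp_all
  have to_fract_prod: "(\<Prod>i\<in>A. to_fract (f i)) = to_fract (\<Prod>i\<in>A. f i)"
    for f :: "'n \<Rightarrow> (nat, 'k) mpoly" and A
    by (induction A rule: infinite_finite_induct) simp_all
  have to_fract_sum: "(\<Sum>i\<in>A. to_fract (f i)) = to_fract (\<Sum>i\<in>A. f i)"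
    for f :: "('n \<Rightarrow>\<^sub>0 nat) \<Rightarrow> (nat, 'k) mpoly" and A
    by (induction A rule: infinite_finite_induct) simp_all
  have prod_mvar: "(\<Prod>i\<in>A. mvar (\<phi> i) ^ Poly_Mapping.lookup m i)
      = Poly_Mapping.single (\<Sum>i\<in>A. Poly_Mapping.single (\<phi> i) (Poly_Mapping.lookup m i)) (1::'k)"
    for A and m
    by (induction A rule: infinite_finite_induct) (simp_all add: mvar_power mult_single)
  have term_eq: "?\<iota> c * (\<Prod>i\<in>UNIV. ?x i ^ Poly_Mapping.lookup m i)
      = to_fract (Poly_Mapping.single (?emb m) c)" for m c
    unfolding to_fract_power to_fract_prod prod_mvar to_fract_mult[symmetric] mult_single
    by (simp only: add_0 mult_1_right)
  have "p = 0" if "eval_via ?\<iota> ?x p = 0" for p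
  proof (rule poly_mapping_eqI)
    fix m
    have "eval_via ?\<iota> ?x p = to_fract (\<Sum>m\<in>Poly_Mapping.keys p.
        Poly_Mapping.single (?emb m) (Poly_Mapping.lookup p m))"
      unfolding eval_via_def term_eq to_fract_sum ..
    with that have "(\<Sum>m\<in>Poly_Mapping.keys p.
        Poly_Mapping.single (?emb m) (Poly_Mapping.lookup p m)) = 0" by (simp only: to_fract_eq_0_iff)
    then have "Poly_Mapping.lookup (\<Sum>m\<in>Poly_Mapping.keys p.
        Poly_Mapping.single (?emb m) (Poly_Mapping.lookup p m)) (?emb m) = 0" by simp
    then show "Poly_Mapping.lookup p m = Poly_Mapping.lookup 0 m"
      unfolding lookup_sum by (simp add: lookup_single inj_emb when_def in_keys_iff split: if_splits)
  qed
  with hom have "generic_point ?\<iota> ?x"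
    by (simp add: generic_point_def field_hom_def generic_point_axioms_def)
  then show ?thesis by blast
qed

text \<open>A vector in the kernel of the Jacobian matrix over the field of rational functions is a
  vector field that kills all the forms.\<close>
theorem jacobian_determinant_nonzero:
  fixes g :: "'n::finite \<Rightarrow> ('n, 'k::{alg_closed_field,field_char_0}) mpoly"
  assumes "\<And>l. g l \<in> homog D" "D > 0"
    and "\<And>a. (\<And>l. meval a (g l) = 0) \<Longrightarrow> a = (\<lambda>_. 0)"
  shows "det (\<chi> l j. partial j (g l)) \<noteq> 0"
proof
  assume det: "det (\<chi> l j. partial j (g l)) = 0"
  obtain \<iota> :: "'k \<Rightarrow> (nat, 'k) mpoly fract" and x :: "'n \<Rightarrow> (nat, 'k) mpoly fract"
    where "generic_point \<iota> x"
    using generic_point_exists by blast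
  then interpret generic_point \<iota> x .
  let ?A = "\<chi> l j. E (partial j (g l))"
  have "det ?A = E (det (\<chi> l j. partial j (g l)))"
    by (simp add: eval_via_det)
  also have "\<dots> = 0" by (simp add: det)
  finally have "\<not> invertible ?A" by (simp add: invertible_det_nz)
  then obtain w where w: "?A *v w = 0" "w \<noteq> 0"
    using matrix_left_invertible_ker[of ?A] by (auto simp: invertible_left_inverse)
  have "vector_field (\<lambda>j. w $ j) (g l) = 0" for l
  proof -
    have "(?A *v w) $ l = 0" by (simp add: w)
    then show ?thesis by (simp add: vector_field_def matrix_vector_mult_def mult.commute)
  qed
  then have "w $ i = 0" for i
    using no_vector_field_kills_forms[of g D "\<lambda>j. w $ j" i] assms by blast
  with w(2) show False by (simp add: vec_eq_iff)
qed

section \<open>Graded pieces\<close>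

lemma homog_zero: "0 \<in> homog e"
  by (simp add: homog_def)

lemma homog_add: "p \<in> homog e \<Longrightarrow> q \<in> homog e \<Longrightarrow> p + q \<in> homog e"
  using keys_add[of p q] by (auto simp: homog_def)

lemma homog_sum: "(\<And>i. i \<in> A \<Longrightarrow> p i \<in> homog e) \<Longrightarrow> sum p A \<in> homog e"
  by (induction A rule: infinite_finite_induct) (simp_all add: homog_zero homog_add)

lemma homog_mult: "p \<in> homog e \<Longrightarrow> q \<in> homog e' \<Longrightarrow> p * q \<in> homog (e + e')"
  using keys_mult[of p q] by (fastforce simp: homog_def mdeg_add)

lemma homog_single: "mdeg m = e \<Longrightarrow> Poly_Mapping.single m c \<in> homog e"
  by (simp add: homog_def)

lemma homog_scale: "p \<in> homog e \<Longrightarrow> Defs.scale c p \<in> homog e"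
  using homog_mult[OF homog_single[of 0 0 c]] by (simp add: Defs.scale_def)

lemma homog_mvar: "mvar i \<in> homog 1"
  by (simp add: mvar_def homog_single mdeg_single)

lemma homog_power: "p \<in> homog 1 \<Longrightarrow> p ^ e \<in> homog e"
proof (induction e)
  case 0
  show ?case using homog_single[of 0 0 1] by simp
next
  case (Suc e)
  then show ?case using homog_mult[of p 1 "p ^ e" e] by simp
qed

lemma homog_subspace: "mpoly_vs.subspace (homog e)"
  by (simp add: mpoly_vs.subspace_def homog_zero homog_add homog_scale)

lemma scale_single: "Defs.scale c (Poly_Mapping.single m c') = Poly_Mapping.single m (c * c')"
  by (simp add: Defs.scale_def mult_single)

lemma lookup_scale: "Poly_Mapping.lookup (Defs.scale c p) m = c * Poly_Mapping.lookup p m"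
  by (induction p rule: mpoly_induct)
     (simp_all add: mpoly_vs.scale_right_distrib lookup_add scale_single lookup_single when_def
        distrib_left)

lemma finite_mdeg: "finite {m :: 'n::finite \<Rightarrow>\<^sub>0 nat. mdeg m = e}"
proof -
  have "Poly_Mapping.lookup m \<in> PiE UNIV (\<lambda>_. {..e})" if "mdeg m = e" for m :: "'n \<Rightarrow>\<^sub>0 nat"
    using that member_le_sum[of _ UNIV "Poly_Mapping.lookup m"] by (auto simp: mdeg_def)
  then have "Poly_Mapping.lookup ` {m. mdeg m = e} \<subseteq> PiE UNIV (\<lambda>_ :: 'n. {..e})" by blast
  then have "finite (Poly_Mapping.lookup ` {m :: 'n \<Rightarrow>\<^sub>0 nat. mdeg m = e})"
    by (rule finite_subset) (intro finite_PiE; simp)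
  then show ?thesis
    by (rule finite_imageD) (simp add: inj_on_def poly_mapping_eqI)
qed

lemma homog_expansion:
  assumes "p \<in> homog e"
  shows "p = (\<Sum>m | mdeg m = e. Defs.scale (Poly_Mapping.lookup p m) (Poly_Mapping.single m 1))"
proof -
  have "(\<Sum>m\<in>Poly_Mapping.keys p. Poly_Mapping.single m (Poly_Mapping.lookup p m))
      = (\<Sum>m | mdeg m = e. Poly_Mapping.single m (Poly_Mapping.lookup p m))"
    using assms by (intro sum.mono_neutral_left finite_mdeg) (auto simp: homog_def in_keys_iff)
  then show ?thesis by (simp add: scale_single flip: mpoly_expansion)
qed

lemma linear_form_homog: "linear_form a \<in> homog 1"
  unfolding linear_form_def by (intro homog_sum homog_single mdeg_single)

lemma lookup_linear_form: "Poly_Mapping.lookup (linear_form a) (Poly_Mapping.single i 1) = a i"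
proof -
  have "Poly_Mapping.single j (1::nat) = Poly_Mapping.single i 1 \<longleftrightarrow> j = i" for j
    by (metis lookup_single_eq lookup_single_not_eq zero_neq_one)
  then show ?thesis by (simp add: linear_form_def lookup_sum lookup_single when_def)
qed

lemma linear_form_altdef: "linear_form a = (\<Sum>i\<in>UNIV. Defs.scale (a i) (mvar i))"
  by (simp add: linear_form_def scale_single mvar_def)

lemma mdeg_one:
  assumes "mdeg m = 1"
  shows "\<exists>i. m = Poly_Mapping.single i 1"
proof -
  from assms obtain i where i: "Poly_Mapping.lookup m i \<noteq> 0"
    unfolding mdeg_def by (metis sum.neutral zero_neq_one)
  have "Poly_Mapping.lookup m i + (\<Sum>j\<in>UNIV - {i}. Poly_Mapping.lookup m j) = 1"
    using assms by (simp add: mdeg_def sum.remove[of UNIV i])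
  with i have "Poly_Mapping.lookup m i = 1" "(\<Sum>j\<in>UNIV - {i}. Poly_Mapping.lookup m j) = 0"
    by linarith+
  then have "m = Poly_Mapping.single i 1"
    by (intro poly_mapping_eqI) (auto simp: lookup_single when_def)
  then show ?thesis ..
qed

lemma homog_one_eq_linear_form:
  assumes "q \<in> homog 1"
  shows "q = linear_form (\<lambda>i. Poly_Mapping.lookup q (Poly_Mapping.single i 1))"
proof (rule poly_mapping_eqI)
  fix m
  show "Poly_Mapping.lookup q m = Poly_Mapping.lookup
      (linear_form (\<lambda>i. Poly_Mapping.lookup q (Poly_Mapping.single i 1))) m"
  proof (cases "mdeg m = 1")
    case True
    then show ?thesis using mdeg_one lookup_linear_form by metis
  next
    case False
    then have "Poly_Mapping.lookup p m = 0" if "p \<in> homog 1" for p :: "('a, 'b) mpoly"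
      using that unfolding homog_def by (metis (mono_tags, lifting) in_keys_iff mem_Collect_eq)
    with assms linear_form_homog show ?thesis by metis
  qed
qed

lemma gradient_ideal_mult: "p \<in> gradient_ideal f \<Longrightarrow> q * p \<in> gradient_ideal f"
  and gradient_ideal_add: "p \<in> gradient_ideal f \<Longrightarrow> p' \<in> gradient_ideal f \<Longrightarrow> p + p' \<in> gradient_ideal f"
  and gradient_ideal_zero: "0 \<in> gradient_ideal f"
proof -
  interpret module "(*) :: ('a, 'b) mpoly \<Rightarrow> _"
    by unfold_locales (simp_all add: algebra_simps)
  show "p \<in> gradient_ideal f \<Longrightarrow> q * p \<in> gradient_ideal f"
    "p \<in> gradient_ideal f \<Longrightarrow> p' \<in> gradient_ideal f \<Longrightarrow> p + p' \<in> gradient_ideal f"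
    "0 \<in> gradient_ideal f"
    unfolding gradient_ideal_def by (fact span_scale span_add span_zero)+
qed

lemma gradient_piece_subspace: "mpoly_vs.subspace (gradient_piece f e)"
  using gradient_ideal_mult[of _ f "Poly_Mapping.single 0 _"]
  by (auto simp: mpoly_vs.subspace_def gradient_piece_def homog_zero homog_add homog_scale
      gradient_ideal_add gradient_ideal_zero Defs.scale_def
      simp flip: Defs.scale_def intro: homog_scale[unfolded Defs.scale_def])

lemma gradient_piece_mult:
  "p \<in> gradient_piece f e \<Longrightarrow> q \<in> homog e' \<Longrightarrow> q * p \<in> gradient_piece f (e' + e)"
  by (simp add: gradient_piece_def gradient_ideal_mult homog_mult)

section \<open>Coordinates on a quotient\<close>

text \<open>Extend a basis of \<open>W\<close> to one of \<open>V\<close>; the coordinates are the coefficients at the added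
  basis vectors.\<close>
lemma (in vector_space) quotient_coordinates:
  assumes V: "subspace V" "finite S" "V \<subseteq> span S" and W: "subspace W" "W \<subseteq> V"
    and dims: "dim V = dim W + CARD('n::finite)"
  shows "\<exists>\<pi> :: 'b \<Rightarrow> 'n \<Rightarrow> 'a.
    (\<forall>u\<in>V. \<forall>v\<in>V. \<forall>l. \<pi> (u + v) l = \<pi> u l + \<pi> v l) \<and>
    (\<forall>c. \<forall>v\<in>V. \<forall>l. \<pi> (scale c v) l = c * \<pi> v l) \<and>
    (\<forall>v\<in>V. (\<forall>l. \<pi> v l = 0) \<longleftrightarrow> v \<in> W)"
proof -
  obtain C where C: "C \<subseteq> W" "independent C" "W \<subseteq> span C" "card C = dim W"
    using basis_exists[of W] by blast
  have "C \<subseteq> V" using C(1) W(2) by blast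
  then obtain B where B: "C \<subseteq> B" "B \<subseteq> V" "independent B" "V \<subseteq> span B"
    using maximal_independent_subset_extend[OF _ C(2)] by blast
  have "B \<subseteq> span S" using B(2) V(3) by blast
  then have finB: "finite B" using independent_span_bound[OF V(2) B(3)] by blast
  have "card B = dim V"
    using basis_card_eq_dim[OF B(2) B(4) B(3)] .
  then have "card (UNIV :: 'n set) = card (B - C)"
    using dims C(4) B(1) finB by (simp add: card_Diff_subset finite_subset)
  then obtain h :: "'n \<Rightarrow> 'b" where h: "bij_betw h UNIV (B - C)"
    using finite_same_card_bij[of "UNIV :: 'n set" "B - C"] finB by auto
  define \<pi> where "\<pi> = (\<lambda>v l. representation B v (h l))"
  have "v \<in> W" if "v \<in> V" "\<And>l. \<pi> v l = 0" for v
  proof -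
    have "representation B v b = 0" if "b \<in> B - C" for b
    proof -
      from that h obtain l where "b = h l" by (metis bij_betw_imp_surj_on imageE)
      with \<open>\<And>l. \<pi> v l = 0\<close> show ?thesis by (simp add: \<pi>_def)
    qed
    then have "(\<Sum>b\<in>B. scale (representation B v b) b) = (\<Sum>b\<in>C. scale (representation B v b) b)"
      using finB B(1) by (intro sum.mono_neutral_right) auto
    moreover have "(\<Sum>b\<in>B. scale (representation B v b) b) = v"
      using sum_representation_eq[OF B(3) _ finB order.refl] that(1) B(4) by blast
    moreover have "(\<Sum>b\<in>C. scale (representation B v b) b) \<in> W"
      using C(1) W(1) by (intro subspace_sum subspace_scale) auto
    ultimately show ?thesis by simp
  qed
  moreover have "\<pi> v l = 0" if "v \<in> W" for v l
  proof -
    have "h l \<notin> C" using h by (auto simp: bij_betw_def)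
    moreover have "representation B v = representation C v"
      using representation_extend[OF B(3) _ B(1)] C(3) that by blast
    ultimately show ?thesis
      unfolding \<pi>_def using representation_ne_zero by metis
  qed
  moreover have "\<pi> (u + v) l = \<pi> u l + \<pi> v l" if "u \<in> V" "v \<in> V" for u v l
    using representation_add[OF B(3), of v u] subsetD[OF B(4)] that by (simp add: \<pi>_def)
  moreover have "\<pi> (scale c v) l = c * \<pi> v l" if "v \<in> V" for c v l
    using representation_scale[OF B(3), of v c] subsetD[OF B(4)] that by (simp add: \<pi>_def)
  ultimately show ?thesis
    by (intro exI[of _ \<pi>]) blast
qed

section \<open>Powers of linear forms\<close>

lemma lookup_mvar_mult:
  "Poly_Mapping.lookup (mvar i * q) m
    = (if Poly_Mapping.lookup m i = 0 then 0 else Poly_Mapping.lookup q (m - Poly_Mapping.single i 1))"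
proof (induction q rule: mpoly_induct)
  case (single m' c)
  show ?case
  proof (cases "Poly_Mapping.lookup m i = 0")
    case True
    then have "Poly_Mapping.single i 1 + m' \<noteq> m" by (auto simp: lookup_add)
    with True show ?thesis by (simp add: mvar_def mult_single lookup_single)
  next
    case False
    then have "m = Poly_Mapping.single i 1 + (m - Poly_Mapping.single i 1)"
      by (intro poly_mapping_eqI) (auto simp: lookup_add lookup_minus lookup_single when_def)
    then have "Poly_Mapping.single i 1 + m' = m \<longleftrightarrow> m' = m - Poly_Mapping.single i 1"
      by (metis add_left_cancel)
    with False show ?thesis by (simp add: mvar_def mult_single lookup_single when_def)
  qed
qed (simp_all add: ring_distribs lookup_add)

lemma lookup_linear_form_mult:
  "Poly_Mapping.lookup (linear_form a * q) m = (\<Sum>i\<in>UNIV. a i * Poly_Mapping.lookup (mvar i * q) m)"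
proof -
  have "linear_form a * q = (\<Sum>i\<in>UNIV. Defs.scale (a i) (mvar i * q))"
    by (simp add: linear_form_altdef sum_distrib_right Defs.scale_def mult.assoc)
  then show ?thesis by (simp add: lookup_sum lookup_scale)
qed

lemmas meval_simps = meval_eq_eval_via id_hom.eval_via_add id_hom.eval_via_mult
  id_hom.eval_via_sum id_hom.eval_via_mvar id_hom.eval_via_zero id_hom.eval_via_one

text \<open>Splitting off one factor expresses the coefficients of \<open>\<ell>\<^bsup>e+1\<^esup>\<close> through those of \<open>\<ell>\<^sup>e\<close>, and
  the product rule for this recursion yields the derivatives \<open>e \<ell>\<^bsup>e-1\<^esup> x\<^sub>j\<close> of \<open>\<ell>\<^sup>e\<close> in the
  coefficients of \<open>\<ell>\<close>.\<close>
lemma coefficients_of_power: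
  "\<exists>G :: ('n::finite \<Rightarrow>\<^sub>0 nat) \<Rightarrow> ('n, 'k::field) mpoly. \<forall>m. G m \<in> homog e \<and>
     (\<forall>a. meval a (G m) = Poly_Mapping.lookup (linear_form a ^ e) m) \<and>
     (\<forall>a j. meval a (partial j (G m))
        = of_nat e * Poly_Mapping.lookup (linear_form a ^ (e - 1) * mvar j) m)"
proof (induction e)
  case 0
  show ?case
    by (rule exI[of _ "\<lambda>m. Poly_Mapping.single 0 (Poly_Mapping.lookup 1 m)"])
       (simp add: homog_single meval_eq_eval_via id_hom.eval_via_const)
next
  case (Suc e)
  then obtain G :: "('n \<Rightarrow>\<^sub>0 nat) \<Rightarrow> ('n, 'k) mpoly" where G: "\<And>m. G m \<in> homog e"
    "\<And>m a. meval a (G m) = Poly_Mapping.lookup (linear_form a ^ e) m"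
    "\<And>m a j. meval a (partial j (G m))
        = of_nat e * Poly_Mapping.lookup (linear_form a ^ (e - 1) * mvar j) m"
    by metis
  define H where "H = (\<lambda>m. \<Sum>i\<in>UNIV. if Poly_Mapping.lookup m i = 0 then 0
    else mvar i * G (m - Poly_Mapping.single i 1))"
  have "H m \<in> homog (Suc e)" for m
    unfolding H_def using homog_mult[OF homog_mvar G(1)] by (intro homog_sum) (auto simp: homog_zero)
  moreover have "meval a (H m) = Poly_Mapping.lookup (linear_form a ^ Suc e) m" for m a
  proof -
    have "meval a (H m) = (\<Sum>i\<in>UNIV. a i * Poly_Mapping.lookup (mvar i * linear_form a ^ e) m)"
      unfolding H_def lookup_mvar_mult meval_eq_eval_via id_hom.eval_via_sum
      using G(2)[of a] by (intro sum.cong) (simp_all add: meval_simps)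
    then show ?thesis by (simp add: lookup_linear_form_mult)
  qed
  moreover have "meval a (partial j (H m))
      = of_nat (Suc e) * Poly_Mapping.lookup (linear_form a ^ (Suc e - 1) * mvar j) m" for m a j
  proof -
    let ?t = "\<lambda>i. (if i = j then Poly_Mapping.lookup (mvar j * linear_form a ^ e) m else 0)
        + of_nat e * (a i * Poly_Mapping.lookup (mvar i * (linear_form a ^ (e - 1) * mvar j)) m)"
    have "meval a (partial j (H m)) = (\<Sum>i\<in>UNIV. meval a (partial j
        (if Poly_Mapping.lookup m i = 0 then 0 else mvar i * G (m - Poly_Mapping.single i 1))))"
      by (simp add: H_def partial_sum meval_simps)
    also have "\<dots> = (\<Sum>i\<in>UNIV. ?t i)"
    proof (intro sum.cong refl)
      fix i
      show "meval a (partial j (if Poly_Mapping.lookup m i = 0 then 0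
          else mvar i * G (m - Poly_Mapping.single i 1))) = ?t i"
        unfolding lookup_mvar_mult using G(2)[of a] G(3)[of a j]
        by (simp add: meval_simps partial_mult partial_mvar)
    qed
    also have "\<dots> = Poly_Mapping.lookup (mvar j * linear_form a ^ e) m
        + of_nat e * Poly_Mapping.lookup (linear_form a * (linear_form a ^ (e - 1) * mvar j)) m"
      by (simp add: sum.distrib lookup_linear_form_mult flip: sum_distrib_left)
    also have "\<dots> = of_nat (Suc e) * Poly_Mapping.lookup (linear_form a ^ e * mvar j) m"
      by (cases e) (simp_all add: mult_ac algebra_simps)
    finally show ?thesis by simp
  qed
  ultimately show ?case by blast
qed


section \<open>Cosets\<close>

lemma coset_eq_iff:
  assumes "mpoly_vs.subspace W"
  shows "x +o W = y +o W \<longleftrightarrow> x - y \<in> W"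
proof
  assume "x +o W = y +o W"
  moreover have "x \<in> x +o W"
    using mpoly_vs.subspace_0[OF assms] by (auto simp: elt_set_plus_def)
  ultimately obtain w where "w \<in> W" "x = y + w" by (auto simp: elt_set_plus_def)
  then show "x - y \<in> W" by simp
next
  assume W: "x - y \<in> W"
  have "x + w = y + (x - y + w)" "y + w = x + (w - (x - y))" for w by simp_all
  moreover have "x - y + w \<in> W" "w - (x - y) \<in> W" if "w \<in> W" for w
    using that W mpoly_vs.subspace_add[OF assms] mpoly_vs.subspace_diff[OF assms] by blast+
  ultimately show "x +o W = y +o W"
    unfolding elt_set_plus_def by blast
qed

lemma coset_add:
  assumes "mpoly_vs.subspace W"
  shows "(x +o W) + (y +o W) = (x + y) +o W"
proof -
  have "W + W = W"
    using mpoly_vs.subspace_add[OF assms] mpoly_vs.subspace_0[OF assms]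
    by (auto simp: set_plus_def) (metis add_0)
  then show ?thesis by (simp add: set_plus_rearrange)
qed

lemma coset_scale:
  assumes "mpoly_vs.subspace W"
  shows "Defs.scale c ` (x +o W) + W = Defs.scale c x +o W"
proof
  show "Defs.scale c ` (x +o W) + W \<subseteq> Defs.scale c x +o W"
  proof
    fix z assume "z \<in> Defs.scale c ` (x +o W) + W"
    then obtain w w' where w: "w \<in> W" "w' \<in> W" and z: "z = Defs.scale c (x + w) + w'"
      by (auto simp: elt_set_plus_def set_plus_def)
    have "Defs.scale c w + w' \<in> W"
      using w by (intro mpoly_vs.subspace_add[OF assms] mpoly_vs.subspace_scale[OF assms])
    moreover have "z = Defs.scale c x + (Defs.scale c w + w')"
      by (simp add: z mpoly_vs.scale_right_distrib add.assoc)
    ultimately show "z \<in> Defs.scale c x +o W" by (auto simp: elt_set_plus_def)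
  qed
  have "x \<in> x +o W"
    using mpoly_vs.subspace_0[OF assms] by (auto simp: elt_set_plus_def)
  then show "Defs.scale c x +o W \<subseteq> Defs.scale c ` (x +o W) + W"
    by (auto simp: elt_set_plus_def[of "Defs.scale c x"] set_plus_def)
qed

lemma singleton_set_plus: "{x} + W = x +o W"
  by (auto simp: set_plus_def elt_set_plus_def)

text \<open>Since the gradient ideal is an ideal, multiplication by \<open>g\<close> maps its piece of degree \<open>a\<close> into
  the one of degree \<open>b\<close>. Injectivity of \<open>R\<^sub>a \<rightarrow> (M\<^sub>f)\<^sub>b\<close> therefore forces the former to be zero, and
  \<open>(M\<^sub>f)\<^sub>a\<close> is \<open>R\<^sub>a\<close> itself.\<close>
lemma milnor_iso_mult:
  assumes g: "g \<in> homog e" and b: "b = e + a"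
    and inj: "\<And>q. q \<in> homog a \<Longrightarrow> g * q \<in> gradient_piece f b \<Longrightarrow> q = 0"
    and surj: "\<And>t. t \<in> homog b \<Longrightarrow> \<exists>q\<in>homog a. g * q - t \<in> gradient_piece f b"
  shows "milnor_iso f a b (milnor_mult f g b)"
proof -
  let ?W = "gradient_piece f b" and ?\<phi> = "milnor_mult f g b"
  note W = gradient_piece_subspace[of f b]
  have "q = 0" if "q \<in> gradient_piece f a" for q
    using inj[of q] gradient_piece_mult[OF that g] that by (simp add: b gradient_piece_def)
  then have zero: "gradient_piece f a = {0}"
    using mpoly_vs.subspace_0[OF gradient_piece_subspace] by blast
  have coset_zero: "q +o {0} = {q}" for q :: "('a, 'b) mpoly"
    by (auto simp: elt_set_plus_def)
  have source: "milnor_piece f a = (\<lambda>q. {q}) ` homog a"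
    by (simp add: milnor_piece_def zero coset_zero)
  have \<phi>: "?\<phi> {q} = (g * q) +o ?W" for q
    by (simp add: milnor_mult_def singleton_set_plus)
  show ?thesis
    unfolding milnor_iso_def
  proof (intro conjI ballI allI)
    show "bij_betw ?\<phi> (milnor_piece f a) (milnor_piece f b)"
      unfolding bij_betw_def
    proof
      have "q = q'" if "q \<in> homog a" "q' \<in> homog a" "(g * q) +o ?W = (g * q') +o ?W" for q q'
      proof -
        have "g * (q - q') \<in> ?W"
          using that(3) by (simp add: coset_eq_iff[OF W] right_diff_distrib)
        with inj[of "q - q'"] mpoly_vs.subspace_diff[OF homog_subspace that(1,2)] show ?thesis
          by simp
      qed
      then show "inj_on ?\<phi> (milnor_piece f a)"
        by (auto simp: inj_on_def source \<phi>)
      show "?\<phi> ` milnor_piece f a = milnor_piece f b"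
      proof
        show "?\<phi> ` milnor_piece f a \<subseteq> milnor_piece f b"
          using homog_mult[OF g, of _ a, folded b]
          unfolding source milnor_piece_def[of f b] by (auto simp: \<phi>)
        show "milnor_piece f b \<subseteq> ?\<phi> ` milnor_piece f a"
        proof
          fix X assume "X \<in> milnor_piece f b"
          then obtain t where t: "t \<in> homog b" "X = t +o ?W" by (auto simp: milnor_piece_def)
          then obtain q where q: "q \<in> homog a" "g * q - t \<in> ?W" using surj by blast
          have "X = ?\<phi> {q}"
            using q(2) coset_eq_iff[OF W, of "g * q" t] by (metis \<phi> t(2))
          with q(1) show "X \<in> ?\<phi> ` milnor_piece f a" by (auto simp: source)
        qed
      qed
    qed
    show "?\<phi> (X + Y) = ?\<phi> X + ?\<phi> Y" if XY: "X \<in> milnor_piece f a" "Y \<in> milnor_piece f a" for X Y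
    proof -
      obtain q q' where "X = {q}" "Y = {q'}" using XY by (auto simp: source)
      moreover have "{q} + {q'} = {q + q'}" by (auto simp: set_plus_def)
      ultimately show ?thesis by (simp add: \<phi> coset_add[OF W] distrib_left)
    qed
    show "?\<phi> (milnor_scale f a c X) = milnor_scale f b c (?\<phi> X)" if X: "X \<in> milnor_piece f a" for c X
    proof -
      obtain q where q: "X = {q}" using X by (auto simp: source)
      have "milnor_scale f a c X = {Defs.scale c q}"
        by (auto simp: milnor_scale_def zero q set_plus_def)
      moreover have "g * Defs.scale c q = Defs.scale c (g * q)"
        by (simp add: Defs.scale_def mult_ac)
      ultimately show ?thesis
        by (simp add: q \<phi> milnor_scale_def coset_scale[OF W])
    qed
  qed
qed

section \<open>The multiplication map\<close>

text \<open>Evaluation at a generic point embeds the polynomial ring into a field.\<close>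
lemma power_nonzero:
  fixes l :: "('n::finite, 'k::{alg_closed_field,field_char_0}) mpoly"
  assumes "l \<noteq> 0"
  shows "l ^ e \<noteq> 0"
proof -
  obtain \<iota> :: "'k \<Rightarrow> (nat, 'k) mpoly fract" and x :: "'n \<Rightarrow> (nat, 'k) mpoly fract"
    where "generic_point \<iota> x"
    using generic_point_exists by blast
  then interpret generic_point \<iota> x .
  have "E l \<noteq> 0" using generic assms by blast
  then have "E (l ^ e) \<noteq> 0" by (simp add: eval_via_power)
  then show ?thesis by auto
qed

text \<open>In one variable every form is a multiple of a power of the variable. This excludes the case
  \<open>T = 1\<close>, in which the target of the multiplication map would have degree \<open>0\<close>.\<close>
lemma not_squarefree_in_one_variable:
  fixes f :: "('n::finite, 'k::field) mpoly"
  assumes "CARD('n) = 1" "f \<in> homog d" "2 \<le> d"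
  shows "\<not> squarefree f"
proof
  assume sqf: "squarefree f"
  obtain i :: 'n where i: "UNIV = {i}" using assms(1) by (metis card_1_singletonE)
  have exponent: "m = Poly_Mapping.single i (mdeg m)" for m
  proof (rule poly_mapping_eqI)
    fix j :: 'n
    have "j = i" using i by blast
    then show "Poly_Mapping.lookup m j = Poly_Mapping.lookup (Poly_Mapping.single i (mdeg m)) j"
      by (simp add: mdeg_def i)
  qed
  let ?c = "Poly_Mapping.lookup f (Poly_Mapping.single i d)"
  have "f = Poly_Mapping.single (Poly_Mapping.single i d) ?c"
  proof (rule poly_mapping_eqI)
    fix m
    show "Poly_Mapping.lookup f m
        = Poly_Mapping.lookup (Poly_Mapping.single (Poly_Mapping.single i d) ?c) m"
    proof (cases "mdeg m = d")
      case True
      then show ?thesis using exponent[of m] by simp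
    next
      case False
      then have "Poly_Mapping.single i d \<noteq> m" by (auto simp: mdeg_single)
      moreover have "m \<notin> Poly_Mapping.keys f" using False assms(2) by (auto simp: homog_def)
      ultimately show ?thesis by (simp add: lookup_single in_keys_iff)
    qed
  qed
  also have "\<dots> = mvar i ^ 2 * Poly_Mapping.single (Poly_Mapping.single i (d - 2)) ?c"
    unfolding mvar_power mult_single single_add[symmetric] le_add_diff_inverse[OF assms(3)] by simp
  finally have "(mvar i)\<^sup>2 dvd f" by (rule dvdI)
  with sqf have "mvar i dvd (1 :: ('n, 'k) mpoly)" by (simp add: squarefree_def)
  then obtain h :: "('n, 'k) mpoly" where "1 = mvar i * h" by (rule dvdE)
  then have "meval (\<lambda>_. 0) (1 :: ('n, 'k) mpoly) = meval (\<lambda>_. 0) (mvar i * h)" by simp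
  then show False by (simp add: meval_simps)
qed

theorem theorem4p1:
  fixes f :: "('n::finite, 'k::{alg_closed_field, field_char_0}) mpoly"
    and d T :: nat
  assumes "3 \<le> d"
    and "f \<in> homog d"
    and "squarefree f"
    and "veronese_avoiding d f"
    and "T = CARD('n) * (d - 2)"
  shows "\<exists>U. zariski_open_linear U \<and> U \<noteq> {} \<and>
           (\<forall>l\<in>U. milnor_iso f 1 (T - 1) (milnor_mult f (l ^ (T - 2)) (T - 1)))"
proof -
  define D where "D = T - 1"
  let ?W = "gradient_piece f D"
  have "T \<noteq> 1"
  proof
    assume "T = 1"
    then have "CARD('n) = 1" using assms(5) by simp
    with not_squarefree_in_one_variable[OF _ assms(2)] assms(1,3) show False by simp
  qed
  moreover have "T > 0" using assms(1,5) by simp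
  ultimately have D: "D > 0" "T - 2 = D - 1" "D = D - 1 + 1" by (simp_all add: D_def)
  have codim: "mpoly_vs.dim (homog D :: ('n, 'k) mpoly set) = mpoly_vs.dim ?W + CARD('n)"
    and avoid: "proj ?W \<inter> veronese D = {}"
    using assms(4) by (simp_all add: veronese_avoiding_def gradient_codim_def Let_def D_def
        flip: assms(5))
  let ?S = "(\<lambda>m. Poly_Mapping.single m 1) ` {m. mdeg m = D} :: ('n, 'k) mpoly set"
  have span: "homog D \<subseteq> mpoly_vs.span ?S"
  proof
    fix p :: "('n, 'k) mpoly" assume "p \<in> homog D"
    show "p \<in> mpoly_vs.span ?S"
      by (subst homog_expansion[OF \<open>p \<in> homog D\<close>])
         (intro mpoly_vs.span_sum mpoly_vs.span_scale mpoly_vs.span_base; simp)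
  qed
  have "finite ?S" using finite_mdeg by blast
  moreover have "?W \<subseteq> homog D" by (simp add: gradient_piece_def)
  ultimately obtain \<pi> :: "('n, 'k) mpoly \<Rightarrow> 'n \<Rightarrow> 'k" where
    coords: "\<forall>u\<in>homog D. \<forall>v\<in>homog D. \<forall>l. \<pi> (u + v) l = \<pi> u l + \<pi> v l"
      "\<forall>c. \<forall>v\<in>homog D. \<forall>l. \<pi> (Defs.scale c v) l = c * \<pi> v l"
      "\<forall>v\<in>homog D. (\<forall>l. \<pi> v l = 0) \<longleftrightarrow> v \<in> ?W"
    using mpoly_vs.quotient_coordinates[OF homog_subspace _ span gradient_piece_subspace _ codim]
    by (elim meta_impE exE conjE)
  have \<pi>_add: "\<pi> (u + v) l = \<pi> u l + \<pi> v l" if "u \<in> homog D" "v \<in> homog D" for u v l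
    using coords(1) that by simp
  have \<pi>_scale: "\<pi> (Defs.scale c v) l = c * \<pi> v l" if "v \<in> homog D" for c v l
    using coords(2) that by simp
  have \<pi>_kernel: "(\<forall>l. \<pi> v l = 0) \<longleftrightarrow> v \<in> ?W" if "v \<in> homog D" for v
    using coords(3) that by simp
  have \<pi>_zero: "\<pi> 0 l = 0" for l
    using \<pi>_add[OF homog_zero homog_zero, of l] by simp
  have \<pi>_sum: "\<pi> (\<Sum>s\<in>A. Defs.scale (c s) (v s)) l = (\<Sum>s\<in>A. c s * \<pi> (v s) l)"
    if "\<And>s. s \<in> A \<Longrightarrow> v s \<in> homog D" for A :: "'s set" and c v l
    using that by (induction A rule: infinite_finite_induct)
      (simp_all add: \<pi>_zero \<pi>_add \<pi>_scale homog_sum homog_scale)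
  have \<pi>_expand: "\<pi> q l = (\<Sum>m | mdeg m = D. Poly_Mapping.lookup q m * \<pi> (Poly_Mapping.single m 1) l)"
    if "q \<in> homog D" for q l
    by (subst homog_expansion[OF that], rule \<pi>_sum) (simp add: homog_single)

  obtain G :: "('n \<Rightarrow>\<^sub>0 nat) \<Rightarrow> ('n, 'k) mpoly" where G: "\<And>m. G m \<in> homog D"
    "\<And>m a. meval a (G m) = Poly_Mapping.lookup (linear_form a ^ D) m"
    "\<And>m a j. meval a (partial j (G m))
        = of_nat D * Poly_Mapping.lookup (linear_form a ^ (D - 1) * mvar j) m"
    using coefficients_of_power[of D] by metis
  \<comment> \<open>The coordinates of \<open>\<ell>\<^sup>D\<close> modulo the gradient ideal, as forms in the coefficients of \<open>\<ell>\<close>.\<close>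
  define g where "g = (\<lambda>l. \<Sum>m | mdeg m = D. Poly_Mapping.single 0 (\<pi> (Poly_Mapping.single m 1) l) * G m)"
  have mult_homog: "linear_form a ^ (D - 1) * q \<in> homog D" if "q \<in> homog 1" for a :: "'n \<Rightarrow> 'k" and q
    using homog_mult[OF homog_power[OF linear_form_homog, of a "D - 1"] that] D(3) by simp
  have g_homog: "g l \<in> homog D" for l
    unfolding g_def by (intro homog_sum homog_scale[unfolded Defs.scale_def] G(1))
  have g_value: "meval a (g l) = \<pi> (linear_form a ^ D) l" for a l
    unfolding \<pi>_expand[OF homog_power[OF linear_form_homog]] G(2)[symmetric]
    by (simp add: g_def meval_simps id_hom.eval_via_const mult.commute)
  have g_partial: "meval a (partial j (g l)) = of_nat D * \<pi> (linear_form a ^ (D - 1) * mvar j) l"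
    for a j l
  proof -
    have "meval a (partial j (g l)) = (\<Sum>m | mdeg m = D. \<pi> (Poly_Mapping.single m 1) l
        * (of_nat D * Poly_Mapping.lookup (linear_form a ^ (D - 1) * mvar j) m))"
      unfolding G(3)[symmetric]
      by (simp add: g_def meval_simps id_hom.eval_via_const partial_sum partial_mult)
    then show ?thesis
      unfolding \<pi>_expand[OF mult_homog[OF homog_mvar]] by (simp add: sum_distrib_left mult_ac)
  qed
  have no_zero: "a = (\<lambda>_. 0)" if "\<And>l. meval a (g l) = 0" for a
  proof (rule ccontr)
    assume "a \<noteq> (\<lambda>_. 0)"
    then obtain i where "a i \<noteq> 0" by auto
    then have nonzero: "linear_form a \<noteq> 0" using lookup_linear_form[of a i] by auto
    have "\<forall>l. \<pi> (linear_form a ^ D) l = 0"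
      using that by (simp add: g_value)
    then have "linear_form a ^ D \<in> ?W"
      by (rule \<pi>_kernel[OF homog_power[OF linear_form_homog], THEN iffD1])
    then have "mpoly_vs.span {linear_form a ^ D} \<in> proj ?W \<inter> veronese D"
      using nonzero power_nonzero[OF nonzero] linear_form_homog
      by (auto simp: proj_def veronese_def)
    with avoid show False by simp
  qed

  define \<Delta> where "\<Delta> = det (\<chi> l j. partial j (g l))"
  have "\<Delta> \<noteq> 0"
    unfolding \<Delta>_def by (rule jacobian_determinant_nonzero[OF g_homog D(1) no_zero])
  then obtain a0 where a0: "meval a0 \<Delta> \<noteq> 0"
    using mpoly_zero_of_function_zero by blast
  let ?coords = "\<lambda>l :: ('n, 'k) mpoly. \<lambda>i. Poly_Mapping.lookup l (Poly_Mapping.single i 1)"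
  define U where "U = {l \<in> homog 1. meval (?coords l) \<Delta> \<noteq> 0}"
  have "zariski_open_linear U"
    unfolding zariski_open_linear_def U_def by (intro exI[of _ "{\<Delta>}"]) simp
  moreover have "linear_form a0 \<in> U"
    using a0 by (simp add: U_def linear_form_homog lookup_linear_form del: One_nat_def)
  moreover have "milnor_iso f 1 D (milnor_mult f (l ^ (D - 1)) D)" if "l \<in> U" for l
  proof -
    define a where "a = ?coords l"
    have l: "l = linear_form a"
      using that homog_one_eq_linear_form by (auto simp: U_def a_def)
    \<comment> \<open>\<open>D\<close> times the matrix of the multiplication map in the coordinates \<open>\<pi>\<close>.\<close>
    define A where "A = (\<chi> i j. meval a (partial j (g i)))"
    have "det A = meval a \<Delta>"
      by (simp add: \<Delta>_def A_def meval_eq_eval_via id_hom.eval_via_det)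
    then have inv: "invertible A"
      using that by (simp add: invertible_det_nz U_def a_def)
    have A_value: "(A *v b) $ i = of_nat D * \<pi> (l ^ (D - 1) * linear_form (($) b)) i" for b i
    proof -
      have "l ^ (D - 1) * linear_form (($) b) = (\<Sum>j\<in>UNIV. Defs.scale (b $ j) (l ^ (D - 1) * mvar j))"
        by (simp add: linear_form_altdef sum_distrib_left Defs.scale_def mult_ac)
      moreover have "\<pi> \<dots> i = (\<Sum>j\<in>UNIV. b $ j * \<pi> (l ^ (D - 1) * mvar j) i)"
        unfolding l by (intro \<pi>_sum mult_homog homog_mvar)
      moreover have "(A *v b) $ i = (\<Sum>j\<in>UNIV. of_nat D * \<pi> (l ^ (D - 1) * mvar j) i * b $ j)"
        by (simp only: A_def l matrix_vector_mult_def g_partial vec_lambda_beta)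
      ultimately show ?thesis
        by (simp add: sum_distrib_left mult_ac)
    qed
    show ?thesis
    proof (rule milnor_iso_mult)
      show "l ^ (D - 1) \<in> homog (D - 1)"
        unfolding l by (intro homog_power linear_form_homog)
      show "D = D - 1 + 1" by (fact D)
      show "q = 0" if q: "q \<in> homog 1" "l ^ (D - 1) * q \<in> ?W" for q
      proof -
        define b :: "'k ^ 'n" where "b = (\<chi> i. ?coords q i)"
        have "($) b = ?coords q" by (auto simp: b_def)
        then have b: "q = linear_form (($) b)"
          using homog_one_eq_linear_form[OF q(1)] by (simp only:)
        have "\<pi> (l ^ (D - 1) * q) i = 0" for i
          using \<pi>_kernel[OF mult_homog[OF q(1)], THEN iffD2, of a] q(2) by (simp only: l)
        then have "A *v b = 0"
          by (simp add: vec_eq_iff A_value flip: b)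
        then have "b = 0"
          using inv matrix_left_invertible_ker[of A] by (auto simp: invertible_left_inverse)
        with b show "q = 0" by (simp add: linear_form_def)
      qed
      show "\<exists>q\<in>homog 1. l ^ (D - 1) * q - t \<in> ?W" if t: "t \<in> homog D" for t
      proof -
        obtain b where b: "A *v b = (\<chi> i. of_nat D * \<pi> t i)"
          using inv matrix_right_invertible_surjective[of A]
          by (metis invertible_right_inverse surjD)
        let ?q = "linear_form (($) b)"
        have q: "l ^ (D - 1) * ?q \<in> homog D"
          unfolding l by (intro mult_homog linear_form_homog)
        have "of_nat D * \<pi> (l ^ (D - 1) * ?q) i = of_nat D * \<pi> t i" for i
          unfolding A_value[symmetric] b by simp
        then have eq: "\<pi> (l ^ (D - 1) * ?q) i = \<pi> t i" for i
          using D(1) by simp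
        have diff: "l ^ (D - 1) * ?q - t \<in> homog D"
          by (rule mpoly_vs.subspace_diff[OF homog_subspace q t])
        have "\<pi> (l ^ (D - 1) * ?q - t) i = 0" for i
          using \<pi>_add[OF diff t, of i] eq[of i] by simp
        then have "l ^ (D - 1) * ?q - t \<in> ?W" using \<pi>_kernel[OF diff] by blast
        then show ?thesis using linear_form_homog by blast
      qed
    qed
  qed
  ultimately show ?thesis
    unfolding D(2) D_def[symmetric] by blast
qed

end
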